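(* There exist a time reparametrization $\alpha$ and a geodesic of $(Q,G)$, denoted in Hamiltonian coordinates by $(p_0,q_0)$, such that $(p(t),q(t)):=(\dot\alpha(t)\,p_0(\alpha(t)),\,q_0(\alpha(t)))$ is a curve in $\mathcal{C}$ for which $\Delta=0$ is not a minimum of the functional $\Delta\mapsto\mathcal{F}(\Delta,p,q)$ on $\mathcal{M}_0(D)$.
   Context: $D=[0,1]^2$ with points $(t,x)$ (time, space); dots are time derivatives. For $q\in L^2([0,1])$ put $\eta(q)(x)=\exp(\int_0^xq(u)\,du)$, $\varphi(q)(x)=\int_0^x\eta(q)(y)\,dy$ (argument $q$ often omitted). $Q=\{q\in L^2([0,1]):\int_0^1q\,dx=0,\ \int_0^1\eta(q)\,dx=1\}$, with Riemannian metric $G(q)(X,X)=\int_0^1X^2/\eta(q)\,dx$. A geodesic $q_0$ of $(Q,G)$ is written in Hamiltonian coordinates as $(p_0,q_0)$ with $\dot q_0=\eta(q_0)p_0$. Write $\langle f,g\rangle_\eta=\int_0^1fg\,\eta\,dx$, $H_2=\begin{bmatrix}1&1/2\\1/2&1/3\end{bmatrix}$, $\pi_q^*(p)=p-\begin{bmatrix}1&\varphi\end{bmatrix}H_2^{-1}\begin{bmatrix}\langle p,1\rangle_\eta\\ \langle p,\varphi\rangle_\eta\end{bmatrix}$. $T_q^*Q$ is identified with the range of $\pi_q^*$, i.e. $\{p\in L^2:\langle p,1\rangle_\eta=\langle p,\varphi\rangle_\eta=0\}$, with norm $\|p\|_q^2=\int_0^1\eta\,p^2dx$; $X^\flat=X/\eta$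 for $X\in T_qQ$. $\mathcal{C}$ is the set of curves $(p(t),q(t))\in T^*Q$, $t\in[0,1]$, with $q\in H^2([0,1],L^2([0,1]))$ and $\dot q=\eta(q)p$, with prescribed initial values $(q(0),p(0))$ (and possibly prescribed final values $(q(1),p(1))$), here those of the curve considered. $\frac{D}{Dt}\dot q$ is the covariant derivative of $\dot q$ along $q$ for $(Q,G)$; explicitly, with $\mathcal{U}(f,q)(x)=\frac12\int_x^1\eta(q)f\,dy$ and $b=\frac32\int_0^1(\int_0^xp\circ\varphi^{-1}dy)^2dx$, $$\Big(\tfrac{D}{Dt}\dot q\Big)^\flat=\dot p+\mathcal{U}(p^2,q)-\begin{bmatrix}1&\varphi\end{bmatrix}H_2^{-1}\begin{bmatrix}0\\ b\end{bmatrix}-(\mathrm{id}-\pi_q^* )(\mathcal{U}(p^2,q)).$$ For a measure $\Delta=\Delta_t\,dt$ on $D$, $\mathcal{U}(\Delta,q)(t,x)=\frac12\int_x^1\eta(q(t))\,d\Delta_t$. Fisher-Rao functional: $r(x,y)=\frac14\frac{y^2}{x}$ if $x>0$, $r(0,0)=0$, $r=+\infty$ otherwise; for finite signed Radon measures $\mu,\nu$ on $D$ and $f\in C^0(D,(0,\infty))$, $\mathrm{FR}_f(\mu,\nu)=\int_Dr(\frac{d\mu}{d\lambda},\frac{d\nu}{d\lambda})f\,d\lambda$ for any positive $\lambda$ dominating $\mu,\nu$. $\mathcal{M}_0(D)$ is the set of positive finite Radon measures $\Delta$ on $D$ with $\Delta_{t=0}=0$. The conditions $\Delta_{t=0}=0$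 and $\partial_t\Delta=\delta$ are understood weakly: $\int_D\partial_tf\,d\Delta+\int_Df\,d\delta=0$ for all continuous $f$ on $D$ that are $C^1$ in $t$ with $f(1,x)=0$ for all $x$. The functional is $$\mathcal{F}(\Delta,p,q)=\mathrm{FR}_\eta(\Delta,\partial_t\Delta)+\int_0^1\Big\|\Big(\tfrac{D}{Dt}\dot q\Big)^\flat+\pi_q^*(\mathcal{U}(\Delta,q))\Big\|_q^2dt+P(p(1),q(1)),$$ with value $+\infty$ if $\partial_t\Delta$ is not a finite Radon measure; $P$ is a real-valued functional on $T^*Q$. A time reparametrization is an increasing function $\alpha$ from $[0,1]$ into the (time) interval of definition $[0,\infty)$ of the geodesic. *)

theory Defs
  imports "HOL-Analysis.Analysis"
begin

text \<open>
  Elements of \<open>L\<^sup>2([0,1])\<close> are handled through Borel representatives on \<open>[0,1]\<close>; equality of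
  classes is almost everywhere equality. A curve \<open>u\<close> of such functions is written \<open>u t x\<close>
  (time first).
\<close>

abbreviation I01 :: "real measure" where
  "I01 \<equiv> restrict_space lborel {0..1}"

definition L2_01 :: "(real \<Rightarrow> real) set" where
  "L2_01 = {f. f \<in> borel_measurable I01 \<and> integrable I01 (\<lambda>x. (f x)\<^sup>2)}"

definition L2_eq :: "(real \<Rightarrow> real) \<Rightarrow> (real \<Rightarrow> real) \<Rightarrow> bool" where
  "L2_eq f g \<longleftrightarrow> (AE x in I01. f x = g x)"

definition L2_norm :: "(real \<Rightarrow> real) \<Rightarrow> real" where
  "L2_norm f = sqrt (LINT x|I01. (f x)\<^sup>2)"


section \<open>The manifold \<open>Q\<close> and its cotangent bundle\<close>

definition eta :: "(real \<Rightarrow> real) \<Rightarrow> real \<Rightarrow> real" where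
  "eta q x = exp (LINT u:{0..x}|lborel. q u)"

definition phi :: "(real \<Rightarrow> real) \<Rightarrow> real \<Rightarrow> real" where
  "phi q x = (LINT y:{0..x}|lborel. eta q y)"

definition Q_space :: "(real \<Rightarrow> real) set" where
  "Q_space = {q \<in> L2_01. (LINT x|I01. q x) = 0 \<and> (LINT x|I01. eta q x) = 1}"

definition inner_eta :: "(real \<Rightarrow> real) \<Rightarrow> (real \<Rightarrow> real) \<Rightarrow> (real \<Rightarrow> real) \<Rightarrow> real" where
  "inner_eta q f g = (LINT x|I01. f x * g x * eta q x)"

definition H2_mat :: "real ^ 2 ^ 2" where
  "H2_mat = vector [vector [1, 1/2], vector [1/2, 1/3]]"

definition span_comb :: "(real \<Rightarrow> real) \<Rightarrow> real ^ 2 \<Rightarrow> real \<Rightarrow> real" where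
  "span_comb q c x = (vector [1, phi q x] :: real ^ 2) \<bullet> (matrix_inv H2_mat *v c)"

definition pi_star :: "(real \<Rightarrow> real) \<Rightarrow> (real \<Rightarrow> real) \<Rightarrow> real \<Rightarrow> real" where
  "pi_star q p x =
     p x - span_comb q (vector [inner_eta q p (\<lambda>_. 1), inner_eta q p (phi q)]) x"

definition cotangent :: "(real \<Rightarrow> real) \<Rightarrow> (real \<Rightarrow> real) set" where
  "cotangent q = {p \<in> L2_01. inner_eta q p (\<lambda>_. 1) = 0 \<and> inner_eta q p (phi q) = 0}"


section \<open>Covariant derivative and geodesics\<close>

definition U_fun :: "(real \<Rightarrow> real) \<Rightarrow> (real \<Rightarrow> real) \<Rightarrow> real \<Rightarrow> real" where
  "U_fun f q x = 1/2 * (LINT y:{x..1}|lborel. eta q y * f y)"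

definition b_coef :: "(real \<Rightarrow> real) \<Rightarrow> (real \<Rightarrow> real) \<Rightarrow> real" where
  "b_coef p q =
     3/2 * (LINT x|I01. (LINT y:{0..x}|lborel. p (the_inv_into {0..1} (phi q) y))\<^sup>2)"

text \<open>
  \<open>covar_flat a p q\<close> is the covector of the covariant derivative of \<open>q'\<close> along a curve in \<open>Q\<close>,
  for the Levi-Civita connection of the metric \<open>G(q)(X,X) = \<integral> X\<^sup>2 / \<eta>(q)\<close>, at a time where
  the position is \<open>q\<close>, the velocity is \<open>\<eta>(q) p\<close> and the time derivative of \<open>p\<close> is \<open>a\<close>.
\<close>

definition covar_flat ::
    "(real \<Rightarrow> real) \<Rightarrow> (real \<Rightarrow> real) \<Rightarrow> (real \<Rightarrow> real) \<Rightarrow> real \<Rightarrow> real" where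
  "covar_flat a p q x =
     a x + U_fun (\<lambda>y. (p y)\<^sup>2) q x
     - span_comb q (vector [0, b_coef p q]) x
     - (U_fun (\<lambda>y. (p y)\<^sup>2) q x - pi_star q (U_fun (\<lambda>y. (p y)\<^sup>2) q) x)"

definition has_L2_derivative ::
    "(real \<Rightarrow> real \<Rightarrow> real) \<Rightarrow> (real \<Rightarrow> real) \<Rightarrow> real \<Rightarrow> real set \<Rightarrow> bool" where
  "has_L2_derivative u v t S \<longleftrightarrow>
     ((\<lambda>s. L2_norm (\<lambda>x. (u s x - u t x) / (s - t) - v x)) \<longlongrightarrow> 0) (at t within S)"

text \<open>A geodesic on \<open>[0,\<infinity>)\<close>: a twice differentiable curve in \<open>Q\<close> (classically, as a curve in
  \<open>L\<^sup>2\<close>) whose velocity has vanishing covariant derivative at all times.\<close>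

definition geodesic :: "(real \<Rightarrow> real \<Rightarrow> real) \<Rightarrow> (real \<Rightarrow> real \<Rightarrow> real) \<Rightarrow> bool" where
  "geodesic p q \<longleftrightarrow>
     (\<forall>t\<ge>0. q t \<in> Q_space \<and> p t \<in> cotangent (q t) \<and>
        has_L2_derivative q (\<lambda>x. eta (q t) x * p t x) t {0..} \<and>
        (\<exists>a\<in>L2_01. has_L2_derivative p a t {0..} \<and>
            (AE x in I01. covar_flat a (p t) (q t) x = 0)))"

definition time_reparametrization :: "(real \<Rightarrow> real) \<Rightarrow> (real \<Rightarrow> real) \<Rightarrow> bool" where
  "time_reparametrization \<alpha> \<alpha>' \<longleftrightarrow>
     strict_mono_on {0..1} \<alpha> \<and> \<alpha> ` {0..1} \<subseteq> {0..} \<and>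
     (\<forall>t\<in>{0..1}. (\<alpha> has_real_derivative \<alpha>' t) (at t within {0..1}))"


section \<open>Sobolev curves and the set \<open>C\<close>\<close>

text \<open>
  \<open>H1_curve u v\<close>: \<open>u\<close> is the continuous representative of an element of \<open>H\<^sup>1([0,1], L\<^sup>2([0,1]))\<close>,
  with derivative \<open>v \<in> L\<^sup>2([0,1], L\<^sup>2([0,1])) = L\<^sup>2([0,1]\<^sup>2)\<close>, i.e.
  \<open>u(t) = u(0) + \<integral>\<^sub>0\<^sup>t v(s) ds\<close> in \<open>L\<^sup>2([0,1])\<close> for every \<open>t\<close>.
\<close>

definition H1_curve :: "(real \<Rightarrow> real \<Rightarrow> real) \<Rightarrow> (real \<Rightarrow> real \<Rightarrow> real) \<Rightarrow> bool" where
  "H1_curve u v \<longleftrightarrow>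
     (\<lambda>(t, x). v t x) \<in> borel_measurable (I01 \<Otimes>\<^sub>M I01) \<and>
     integrable (I01 \<Otimes>\<^sub>M I01) (\<lambda>(t, x). (v t x)\<^sup>2) \<and>
     (\<forall>t\<in>{0..1}. u t \<in> L2_01 \<and>
        L2_eq (u t) (\<lambda>x. u 0 x + (LINT s:{0..t}|lborel. v s x)))"

definition H1_deriv :: "(real \<Rightarrow> real \<Rightarrow> real) \<Rightarrow> real \<Rightarrow> real \<Rightarrow> real" where
  "H1_deriv u = (SOME v. H1_curve u v)"

definition H2_curve ::
    "(real \<Rightarrow> real \<Rightarrow> real) \<Rightarrow> (real \<Rightarrow> real \<Rightarrow> real) \<Rightarrow> (real \<Rightarrow> real \<Rightarrow> real) \<Rightarrow> bool" where
  "H2_curve q v a \<longleftrightarrow> H1_curve q v \<and> H1_curve v a"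

text \<open>Points of the cotangent bundle are pairs \<open>(p, q)\<close>. The final value is prescribed only if
  \<open>fin\<close> is not \<open>None\<close>. By \<open>H1_curve v a\<close>, \<open>v\<close> is the continuous representative of \<open>q'\<close>, so that
  \<open>q' = \<eta>(q) p\<close> can be required at every time.\<close>

definition curves_C ::
    "(real \<Rightarrow> real) \<times> (real \<Rightarrow> real) \<Rightarrow> ((real \<Rightarrow> real) \<times> (real \<Rightarrow> real)) option \<Rightarrow>
     ((real \<Rightarrow> real \<Rightarrow> real) \<times> (real \<Rightarrow> real \<Rightarrow> real)) set" where
  "curves_C init fin =
     {(p, q).
        (\<forall>t\<in>{0..1}. q t \<in> Q_space \<and> p t \<in> cotangent (q t)) \<and>
        (\<exists>v a. H2_curve q v a \<and>
           (\<forall>t\<in>{0..1}. L2_eq (v t) (\<lambda>x. eta (q t) x * p t x))) \<and>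
        L2_eq (p 0) (fst init) \<and> L2_eq (q 0) (snd init) \<and>
        (case fin of None \<Rightarrow> True
         | Some z \<Rightarrow> L2_eq (p 1) (fst z) \<and> L2_eq (q 1) (snd z))}"


section \<open>Measures on the unit square\<close>

definition unit_square :: "(real \<times> real) set" where
  "unit_square = {0..1} \<times> {0..1}"

text \<open>On the compact metric space \<open>D = [0,1]\<^sup>2\<close>, finite Borel measures are Radon measures.\<close>

definition radon_D :: "(real \<times> real) measure set" where
  "radon_D = {\<mu>. finite_measure \<mu> \<and> sets \<mu> = sets (restrict_space borel unit_square)}"

definition zero_D :: "(real \<times> real) measure" where
  "zero_D = null_measure (restrict_space borel unit_square)"

text \<open>A pair \<open>(\<mu>, \<nu>)\<close> represents the finite signed Radon measure \<open>\<mu> - \<nu>\<close>; the two parts are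
  not required to be mutually singular.\<close>

type_synonym signed = "(real \<times> real) measure \<times> (real \<times> real) measure"

definition signed_D :: "signed set" where
  "signed_D = radon_D \<times> radon_D"

definition signed_integral :: "signed \<Rightarrow> (real \<times> real \<Rightarrow> real) \<Rightarrow> real" where
  "signed_integral \<delta> f = (LINT z|fst \<delta>. f z) - (LINT z|snd \<delta>. f z)"

definition signed_density :: "(real \<times> real) measure \<Rightarrow> signed \<Rightarrow> real \<times> real \<Rightarrow> real" where
  "signed_density lam \<delta> z =
     enn2real (RN_deriv lam (fst \<delta>) z) - enn2real (RN_deriv lam (snd \<delta>) z)"

definition fr_integrand :: "real \<Rightarrow> real \<Rightarrow> ennreal" where
  "fr_integrand x y =
     (if x > 0 then ennreal (1/4 * (y\<^sup>2 / x)) else if x = 0 \<and> y = 0 then 0 else \<infinity>)"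

text \<open>The integrand is positively 1-homogeneous, hence the value does not depend on the
  dominating measure. The sum of the four positive parts serves as dominating measure.\<close>

definition dominating :: "signed \<Rightarrow> signed \<Rightarrow> (real \<times> real) measure" where
  "dominating \<mu> \<nu> = measure_of unit_square (sets (restrict_space borel unit_square))
     (\<lambda>A. emeasure (fst \<mu>) A + emeasure (snd \<mu>) A + emeasure (fst \<nu>) A + emeasure (snd \<nu>) A)"

definition FR :: "(real \<times> real \<Rightarrow> real) \<Rightarrow> signed \<Rightarrow> signed \<Rightarrow> ennreal" where
  "FR f \<mu> \<nu> = (let lam = dominating \<mu> \<nu> in
     \<integral>\<^sup>+ z. fr_integrand (signed_density lam \<mu> z) (signed_density lam \<nu> z) * ennreal (f z) \<partial>lam)"

text \<open>\<open>test_function f f'\<close>: \<open>f\<close> is continuous, vanishes at time 1, and has the (jointly)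
  continuous time derivative \<open>f'\<close>.\<close>

definition test_function :: "(real \<times> real \<Rightarrow> real) \<Rightarrow> (real \<times> real \<Rightarrow> real) \<Rightarrow> bool" where
  "test_function f f' \<longleftrightarrow>
     continuous_on unit_square f \<and> continuous_on unit_square f' \<and>
     (\<forall>t\<in>{0..1}. \<forall>x\<in>{0..1}.
        ((\<lambda>s. f (s, x)) has_real_derivative f' (t, x)) (at t within {0..1})) \<and>
     (\<forall>x\<in>{0..1}. f (1, x) = 0)"

text \<open>The weak form of \<open>\<Delta>\<^bsub>t=0\<^esub> = 0\<close> and \<open>\<partial>\<^sub>t\<Delta> = \<delta>\<close> together: the test functions need not
  vanish at time 0.\<close>

definition weak_time_derivative :: "(real \<times> real) measure \<Rightarrow> signed \<Rightarrow> bool" where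
  "weak_time_derivative \<Delta> \<delta> \<longleftrightarrow>
     (\<forall>f f'. test_function f f' \<longrightarrow> (LINT z|\<Delta>. f' z) + signed_integral \<delta> f = 0)"

text \<open>
  \<open>\<Delta>\<^bsub>t=0\<^esub> = 0\<close> alone: whenever the time derivative of \<open>\<Delta>\<close> away from \<open>t = 0\<close> (test functions
  vanishing at both ends) is a finite measure \<open>\<delta>\<close>, integration by parts produces no boundary term
  at \<open>t = 0\<close>. If that derivative is not a finite measure, then \<open>\<Delta>\<close> need not have a trace; such
  \<open>\<Delta>\<close> are not excluded here, and the functional below is \<open>+\<infinity>\<close> on them.
\<close>

definition zero_initial_trace :: "(real \<times> real) measure \<Rightarrow> bool" where
  "zero_initial_trace \<Delta> \<longleftrightarrow>
     (\<forall>\<delta>\<in>signed_D.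
        emeasure (fst \<delta>) ({0} \<times> {0..1}) = 0 \<and> emeasure (snd \<delta>) ({0} \<times> {0..1}) = 0 \<and>
        (\<forall>f f'. test_function f f' \<and> (\<forall>x\<in>{0..1}. f (0, x) = 0) \<longrightarrow>
           (LINT z|\<Delta>. f' z) + signed_integral \<delta> f = 0)
        \<longrightarrow> weak_time_derivative \<Delta> \<delta>)"

definition M0 :: "(real \<times> real) measure set" where
  "M0 = {\<Delta> \<in> radon_D. zero_initial_trace \<Delta>}"

text \<open>\<open>disintegration \<Delta> K\<close>: \<open>\<Delta> = K\<^sub>t dt\<close>. The family \<open>K\<close> is determined by \<open>\<Delta>\<close> for almost every
  \<open>t\<close>, and it exists whenever \<open>weak_time_derivative \<Delta> \<delta>\<close> for some finite \<open>\<delta>\<close>.\<close>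

definition disintegration :: "(real \<times> real) measure \<Rightarrow> (real \<Rightarrow> real measure) \<Rightarrow> bool" where
  "disintegration \<Delta> K \<longleftrightarrow>
     (\<forall>t\<in>{0..1}. finite_measure (K t) \<and> sets (K t) = sets (restrict_space borel {0..1})) \<and>
     (\<forall>B\<in>sets (restrict_space borel {0..1}). (\<lambda>t. emeasure (K t) B) \<in> borel_measurable I01) \<and>
     (\<forall>A\<in>sets \<Delta>. emeasure \<Delta> A = (\<integral>\<^sup>+ t. emeasure (K t) (Pair t -` A) \<partial>I01))"

definition U_meas ::
    "(real \<times> real) measure \<Rightarrow> (real \<Rightarrow> real \<Rightarrow> real) \<Rightarrow> real \<Rightarrow> real \<Rightarrow> real" where
  "U_meas \<Delta> q = (let K = (SOME K. disintegration \<Delta> K) in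
     (\<lambda>t x. 1/2 * (LINT y:{x..1}|K t. eta (q t) y)))"


section \<open>The functional\<close>

text \<open>\<open>FR\<^sub>\<eta>(\<Delta>, \<partial>\<^sub>t\<Delta>)\<close>. The infimum only serves to select \<open>\<partial>\<^sub>t\<Delta>\<close>: the weak formulation
  determines \<open>\<delta>\<close> up to a part carried by \<open>{1} \<times> [0,1]\<close>, where the test functions vanish. Since
  \<open>\<Delta>\<close> does not charge that set, any such part makes the term infinite. If \<open>\<partial>\<^sub>t\<Delta>\<close> is
  not a finite measure, the infimum is over the empty set and equals \<open>\<infinity>\<close>.\<close>

definition FR_term :: "(real \<times> real) measure \<Rightarrow> (real \<Rightarrow> real \<Rightarrow> real) \<Rightarrow> ennreal" where
  "FR_term \<Delta> q =
     (INF \<delta> \<in> {\<delta> \<in> signed_D. weak_time_derivative \<Delta> \<delta>}.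
        FR (\<lambda>(t, x). eta (q t) x) (\<Delta>, zero_D) \<delta>)"

definition F_functional ::
    "((real \<Rightarrow> real) \<Rightarrow> (real \<Rightarrow> real) \<Rightarrow> real) \<Rightarrow>
     (real \<times> real) measure \<Rightarrow> (real \<Rightarrow> real \<Rightarrow> real) \<Rightarrow> (real \<Rightarrow> real \<Rightarrow> real) \<Rightarrow> ereal" where
  "F_functional P \<Delta> p q =
     enn2ereal
       (FR_term \<Delta> q +
        (\<integral>\<^sup>+ t. (\<integral>\<^sup>+ x. ennreal (eta (q t) x *
            (covar_flat (H1_deriv p t) (p t) (q t) x + pi_star (q t) (U_meas \<Delta> q t) x)\<^sup>2)
          \<partial>I01) \<partial>I01))
     + ereal (P (p 1) (q 1))"

end

theory Submission
  imports Defs "HOL-Real_Asymp.Real_Asymp"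
begin

text \<open>
  In terms of \<open>\<phi>\<close>, the metric \<open>G\<close> is the right-invariant metric \<open>\<integral> (v'')\<^sup>2\<close> on diffeomorphisms of
  \<open>[0,1]\<close>, where \<open>v\<close> is the spatial velocity and \<open>p = v'' \<circ> \<phi>\<close>. A suitable cubic spline \<open>v\<close> with a
  single knot at \<open>1/2\<close> is a stationary solution of its Euler equation, so its flow is a geodesic defined
  for all times, with \<open>\<eta> = exp (- s / 2)\<close> at the knot and \<open>\<parallel>p\<parallel>\<^sup>2 = 4\<close>.

  Along the reparametrization \<open>\<alpha>\<close> the covariant derivative is \<open>\<alpha>'' p\<close>. For \<open>\<Delta> = t\<^sup>2 dt\<close> on the line
  \<open>x = 1/2\<close>, the covector \<open>\<pi>\<^sup>*(U(\<Delta>, q))\<close> equals \<open>- t\<^sup>2 exp (- \<alpha> / 2) / 16\<close> times \<open>p\<close>, which lowers the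
  second term to first order by \<open>\<integral> \<alpha>'' t\<^sup>2 exp (- \<alpha> / 2) / 2\<close>, whereas the Fisher-Rao term is only
  \<open>\<integral> exp (- \<alpha> / 2)\<close>. With \<open>\<alpha> = t\<^sup>6\<close> the gain exceeds the cost.
\<close>

section \<open>The velocity field and its flow\<close>

text \<open>Two demands fix the spline. For a stationary field v the geodesic equation,
  differentiated once in space, reads (v v''')' - (v'')^2 / 2 = const. And U of a measure carried by
  one trajectory is a step function, whose projection is affine on each side of a jump; for the
  perturbation to be exactly parallel to p, v'' must be a multiple of such a function, so v''' is
  the same constant on both sides. With v = 0 at the jump, the jump sits on a resting particle and v
  v''' is a constant multiple of v. The equation then makes (v'')^2 continuous, so v'' can only
  change sign there. Parallelism turns the second term of the functional into a scalar integral.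

  The formulas for the Jacobian and for q are 0/0 at the three zeros of v. Identities are therefore
  proved pointwise away from the zeros, and continuity at the zeros comes from estimates along
  trajectories. Moreover \<open>H1_deriv\<close> and the disintegration inside \<open>U_meas\<close>
  are arbitrary choices, which have to be identified almost everywhere by uniqueness
  arguments.\<close>

text \<open>
  The field is a cubic spline, odd about \<open>1/2\<close>, with \<open>v = v' = 0\<close> at both ends and \<open>v = 0\<close> at the
  knot \<open>1/2\<close>. There \<open>v''\<close> jumps from \<open>-4\<close> to \<open>4\<close>, so that \<open>(v'')\<^sup>2\<close> is continuous; this makes \<open>v\<close> a
  stationary solution of the Euler equation of the metric. \<open>ddvel\<close> takes the left limit at the knot.
\<close>

definition vel :: "real \<Rightarrow> real" where
  "vel x = (if x \<le> 1/2 then x\<^sup>2 * (1 - 2 * x) else (1 - x)\<^sup>2 * (1 - 2 * x))"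

definition dvel :: "real \<Rightarrow> real" where
  "dvel x = (if x \<le> 1/2 then 2 * x - 6 * x\<^sup>2 else 2 * (1 - x) - 6 * (1 - x)\<^sup>2)"

definition ddvel :: "real \<Rightarrow> real" where
  "ddvel x = (if x \<le> 1/2 then 2 - 12 * x else 10 - 12 * x)"

lemma DERIV_glue:
  fixes f g h :: "real \<Rightarrow> real"
  assumes f: "\<And>x. x \<le> c \<Longrightarrow> (f has_real_derivative f' x) (at x)"
    and g: "\<And>x. c \<le> x \<Longrightarrow> (g has_real_derivative g' x) (at x)"
    and "f c = g c" "f' c = g' c"
  shows "((\<lambda>x. if x \<le> c then f x else g x) has_real_derivative (if x \<le> c then f' x else g' x)) (at x)"
proof -
  have "((\<lambda>x. if x \<in> {..c} then f x else g x) has_field_derivative (if x \<in> {..c} then f' x else g' x))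
      (at x within ({..c} \<union> {c..}))"
    unfolding has_field_derivative_def
    by (rule has_derivative_eq_rhs, rule has_derivative_If_within_closures[where f' = "\<lambda>x h. f' x * h" and g' = "\<lambda>x h. g' x * h"])
      (use assms in \<open>auto simp: has_field_derivative_def closure_insert intro: has_derivative_at_withinI\<close>)
  moreover have "{..c} \<union> {c..} = UNIV" by auto
  ultimately show ?thesis by simp
qed

text \<open>Away from the seam only one branch matters locally, so nothing has to match there. This
  serves functions with a corner or a jump at the knot.\<close>

lemma DERIV_glue_off:
  fixes f g h :: "real \<Rightarrow> real"
  assumes f: "x < c \<Longrightarrow> (f has_real_derivative f') (at x)"
    and g: "c < x \<Longrightarrow> (g has_real_derivative g') (at x)"
    and "x \<noteq> c"
  shows "((\<lambda>x. if x \<le> c then f x else g x) has_real_derivative (if x \<le> c then f' else g')) (at x)"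
proof (cases "x < c")
  case True
  then show ?thesis
    using f[OF True] by (auto intro!: has_field_derivative_transform_within_open[where S = "{..<c}" and f = f])
next
  case False
  then have "c < x" using assms(3) by simp
  then show ?thesis
    using g by (auto intro!: has_field_derivative_transform_within_open[where S = "{c<..}" and f = g])
qed

lemma DERIV_vel: "(vel has_real_derivative dvel x) (at x)"
  unfolding vel_def[abs_def] dvel_def
  by (rule DERIV_glue) (auto intro!: derivative_eq_intros simp: power2_eq_square field_simps)

lemma DERIV_dvel: "x \<noteq> 1/2 \<Longrightarrow> (dvel has_real_derivative ddvel x) (at x)"
  unfolding dvel_def[abs_def] ddvel_def
  by (rule DERIV_glue_off) (auto intro!: derivative_eq_intros simp: power2_eq_square field_simps)

lemma DERIV_ddvel:
  assumes "x \<noteq> 1/2"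
  shows "(ddvel has_real_derivative -12) (at x)"
proof -
  have "(ddvel has_real_derivative (if x \<le> 1/2 then -12 else -12)) (at x)"
    unfolding ddvel_def[abs_def]
    by (rule DERIV_glue_off) (use assms in \<open>auto intro!: derivative_eq_intros\<close>)
  then show ?thesis by simp
qed

lemma continuous_on_vel: "continuous_on A vel"
  using DERIV_vel DERIV_isCont continuous_at_imp_continuous_on by blast

lemma continuous_on_dvel: "continuous_on A dvel"
proof -
  have "continuous_on ({..1/2} \<union> {1/2..}) (\<lambda>x. if x \<le> 1/2 then 2 * x - 6 * x\<^sup>2 else 2 * (1 - x) - 6 * (1 - x)\<^sup>2 :: real)"
  proof (rule continuous_on_If)
    fix x :: real
    assume "x \<in> {1/2..}" "x \<le> 1/2"
    then have x: "x = 1/2" by simp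
    show "2 * x - 6 * x\<^sup>2 = 2 * (1 - x) - 6 * (1 - x)\<^sup>2" unfolding x by simp
  qed (auto intro!: continuous_intros)
  moreover have "{..1/2} \<union> {1/2..} = (UNIV :: real set)" by auto
  ultimately show ?thesis unfolding dvel_def[abs_def] by (auto intro: continuous_on_subset)
qed

lemma borel_measurable_vel [measurable]: "vel \<in> borel_measurable borel"
  unfolding vel_def[abs_def] by measurable

lemma borel_measurable_dvel [measurable]: "dvel \<in> borel_measurable borel"
  unfolding dvel_def[abs_def] by measurable

lemma borel_measurable_ddvel [measurable]: "ddvel \<in> borel_measurable borel"
  unfolding ddvel_def[abs_def] by measurable

lemma vel_reflect: "vel (1 - x) = - vel x"
proof -
  consider "x < 1/2" | "x = 1/2" | "1/2 < x" by linarith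
  then show ?thesis
  proof cases
    case 2
    show ?thesis unfolding 2 by (simp add: vel_def)
  qed (simp_all add: vel_def algebra_simps)
qed

text \<open>The stationary Euler equation itself: with v''' = -12 off the knot, constancy of (v
  v''')' - (v'')^2 / 2 says that (v'')^2 + 24 v' is constant. It also provides the antiderivative 4
  y - 24 v of (v'')^2.\<close>

lemma ddvel_sq: "(ddvel x)\<^sup>2 = 4 - 24 * dvel x"
  by (auto simp: ddvel_def dvel_def algebra_simps power2_eq_square)

text \<open>An antiderivative of \<open>1 / vel\<close> on \<open>(0, 1/2)\<close>, by partial fractions.\<close>

definition hit_time :: "real \<Rightarrow> real" where
  "hit_time x = - (1 / x) + 2 * ln x - 2 * ln (1 - 2 * x)"

text \<open>The interval (0, 1/2) is a single trajectory. \<open>hit_time\<close> grows at unit rate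
  along it, so in this coordinate the flow is a translation and \<open>half_flow\<close> is the
  position at a given time.\<close>

definition half_flow :: "real \<Rightarrow> real" where
  "half_flow = the_inv_into {0<..<1/2} hit_time"

lemma borel_measurable_hit_time [measurable]: "hit_time \<in> borel_measurable borel"
  unfolding hit_time_def[abs_def] by measurable

lemma vel_pos: "x \<in> {0<..<1/2} \<Longrightarrow> vel x > 0"
  by (auto simp: vel_def)

lemma DERIV_hit_time:
  assumes "x \<in> {0<..<1/2}"
  shows "(hit_time has_real_derivative 1 / vel x) (at x)"
proof -
  have x: "0 < x" "1 - 2 * x > 0" using assms by auto
  have "1 / x\<^sup>2 + 2 / x + 4 / (1 - 2 * x) = 1 / (x\<^sup>2 * (1 - 2 * x))"
    using x by (simp add: divide_simps power2_eq_square) (simp add: algebra_simps)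
  moreover have "(hit_time has_real_derivative (1 / x\<^sup>2 + 2 / x + 4 / (1 - 2 * x))) (at x)"
    unfolding hit_time_def[abs_def]
    using x by (auto intro!: derivative_eq_intros simp: power2_eq_square field_simps)
  ultimately show ?thesis using assms by (simp add: vel_def)
qed

lemma isCont_hit_time: "x \<in> {0<..<1/2} \<Longrightarrow> isCont hit_time x"
  by (rule DERIV_isCont[OF DERIV_hit_time])

lemma hit_time_strict_mono:
  assumes "0 < x" "x < y" "y < 1/2"
  shows "hit_time x < hit_time y"
proof (rule DERIV_pos_imp_increasing_open[OF assms(2)])
  show "\<exists>d. (hit_time has_real_derivative d) (at z) \<and> 0 < d" if "x < z" "z < y" for z
    using DERIV_hit_time[of z] vel_pos[of z] that assms by auto
  show "continuous_on {x..y} hit_time"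
    using assms by (intro continuous_at_imp_continuous_on ballI isCont_hit_time) auto
qed

text \<open>The integral of 1 / v diverges at both ends, like 1 / x at the double zero 0 and
  logarithmically at the simple zero 1/2. Hence no trajectory reaches a zero in finite time, and the
  flow is defined for all times.\<close>

lemma bij_betw_hit_time: "bij_betw hit_time {0<..<1/2} UNIV"
  unfolding bij_betw_def
proof
  show "inj_on hit_time {0<..<1/2}"
    by (rule linorder_inj_onI') (use hit_time_strict_mono in fastforce)
  have "s \<in> hit_time ` {0<..<1/2}" for s
  proof -
    have "filterlim hit_time at_bot (at_right 0)" unfolding hit_time_def[abs_def] by real_asymp
    then have "eventually (\<lambda>x. hit_time x \<le> s) (at_right 0)"
      by (simp add: filterlim_at_bot)
    moreover have "eventually (\<lambda>x. x \<in> {0<..<1/4}) (at_right (0::real))"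
      by (rule eventually_at_right_real) simp
    ultimately have "eventually (\<lambda>x. hit_time x \<le> s \<and> x \<in> {0<..<1/4}) (at_right 0)"
      by (rule eventually_conj)
    then obtain a where a: "hit_time a \<le> s" "a \<in> {0<..<1/4}"
      using eventually_happens trivial_limit_at_right_real by blast
    have "filterlim hit_time at_top (at_left (1/2))" unfolding hit_time_def[abs_def] by real_asymp
    then have "eventually (\<lambda>x. s \<le> hit_time x) (at_left (1/2))"
      by (simp add: filterlim_at_top)
    moreover have "eventually (\<lambda>x. x \<in> {1/4<..<1/2}) (at_left (1/2::real))"
      by (rule eventually_at_left_real) simp
    ultimately have "eventually (\<lambda>x. s \<le> hit_time x \<and> x \<in> {1/4<..<1/2}) (at_left (1/2))"
      by (rule eventually_conj)
    then obtain b where b: "s \<le> hit_time b" "b \<in> {1/4<..<1/2}"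
      using eventually_happens trivial_limit_at_left_real by blast
    have "\<exists>x\<ge>a. x \<le> b \<and> hit_time x = s"
      using a b by (intro IVT) (auto intro!: isCont_hit_time)
    then show ?thesis using a b by auto
  qed
  then show "hit_time ` {0<..<1/2} = UNIV" by auto
qed

lemma half_flow_in: "half_flow s \<in> {0<..<1/2}"
  unfolding half_flow_def
  using the_inv_into_into[OF bij_betw_imp_inj_on[OF bij_betw_hit_time] _ order.refl]
    bij_betw_imp_surj_on[OF bij_betw_hit_time] by auto

lemma hit_time_half_flow [simp]: "hit_time (half_flow s) = s"
  unfolding half_flow_def
  using f_the_inv_into_f_bij_betw[OF bij_betw_hit_time] by auto

lemma half_flow_hit_time: "x \<in> {0<..<1/2} \<Longrightarrow> half_flow (hit_time x) = x"
  unfolding half_flow_def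
  using the_inv_into_f_f[OF bij_betw_imp_inj_on[OF bij_betw_hit_time]] by auto

lemma DERIV_half_flow: "(half_flow has_real_derivative vel (half_flow s)) (at s)"
proof -
  define x where "x = half_flow s"
  have x: "x \<in> {0<..<1/2}" unfolding x_def by (rule half_flow_in)
  have "isCont half_flow (hit_time x)"
    by (rule isCont_inverse_function2[where a = "x / 2" and b = "(x + 1/2) / 2"])
      (use x half_flow_hit_time in \<open>auto intro!: isCont_hit_time\<close>)
  then have "isCont half_flow s" by (simp add: x_def)
  then have "(half_flow has_real_derivative inverse (1 / vel (half_flow s))) (at s)"
    by (intro DERIV_inverse_function[where f = hit_time and a = "s - 1" and b = "s + 1"])
      (use DERIV_hit_time[OF x] vel_pos[OF x] in \<open>auto simp: x_def\<close>)
  then show ?thesis by simp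
qed

lemma borel_measurable_half_flow [measurable]: "half_flow \<in> borel_measurable borel"
  by (intro borel_measurable_continuous_onI continuous_at_imp_continuous_on ballI
      DERIV_isCont[OF DERIV_half_flow])

text \<open>Translation in the time coordinate on the left half, its mirror image on the right half.
  The value \<open>x\<close> covers the fixed points and, outside the unit interval, makes the map
  invertible on the whole line.\<close>

definition flow :: "real \<Rightarrow> real \<Rightarrow> real" where
  "flow t x = (if 0 < x \<and> x < 1/2 then half_flow (hit_time x + t)
     else if 1/2 < x \<and> x < 1 then 1 - half_flow (hit_time (1 - x) + t) else x)"

text \<open>The zeros 0 and 1 are removed together with the knot, because the formulas below divide
  by \<open>vel x\<close>. The set has full measure in the unit interval.\<close>

abbreviation noknot :: "real set" where
  "noknot \<equiv> {0<..<1/2} \<union> {1/2<..<1}"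

lemma flow_simps [simp]: "flow t 0 = 0" "flow t (1/2) = 1/2" "flow t 1 = 1"
  by (auto simp: flow_def)

lemma flow_zero [simp]: "flow 0 x = x"
  using half_flow_hit_time by (auto simp: flow_def)

lemma flow_reflect: "flow t (1 - x) = 1 - flow t x"
  by (auto simp: flow_def)

lemma flow_left: "x \<in> {0<..<1/2} \<Longrightarrow> flow t x \<in> {0<..<1/2}"
  using half_flow_in by (auto simp: flow_def)

lemma flow_right: "x \<in> {1/2<..<1} \<Longrightarrow> flow t x \<in> {1/2<..<1}"
  using half_flow_in[of "hit_time (1 - x) + t"] by (auto simp: flow_def)

lemma flow_noknot: "x \<in> noknot \<Longrightarrow> flow t x \<in> noknot"
  using flow_left flow_right by blast

lemma flow_in: "x \<in> {0..1} \<Longrightarrow> flow t x \<in> {0..1}"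
proof -
  assume "x \<in> {0..1}"
  then consider "x = 0" | "x = 1/2" | "x = 1" | "x \<in> {0<..<1/2}" | "x \<in> {1/2<..<1}" by fastforce
  then show ?thesis
  proof cases
    case 2
    show ?thesis unfolding 2 by simp
  qed (use flow_left[of x t] flow_right[of x t] in auto)
qed

lemma flow_le_half_iff: "x \<in> {0..1} \<Longrightarrow> flow t x \<le> 1/2 \<longleftrightarrow> x \<le> 1/2"
proof -
  assume "x \<in> {0..1}"
  then consider "x = 0" | "x = 1/2" | "x = 1" | "x \<in> {0<..<1/2}" | "x \<in> {1/2<..<1}" by fastforce
  then show ?thesis
  proof cases
    case 2
    show ?thesis unfolding 2 by simp
  qed (use flow_left[of x t] flow_right[of x t] in auto)
qed

lemma borel_measurable_flow [measurable]: "(\<lambda>(t, x). flow t x) \<in> borel_measurable (borel \<Otimes>\<^sub>M borel)"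
  unfolding flow_def[abs_def] by measurable

lemma DERIV_flow_time:
  assumes "x \<in> noknot"
  shows "((\<lambda>t. flow t x) has_real_derivative vel (flow t x)) (at t)"
proof (cases "x < 1/2")
  case True
  have "((\<lambda>t. half_flow (hit_time x + t)) has_real_derivative vel (half_flow (hit_time x + t)) * 1) (at t)"
    by (rule DERIV_chain2[OF DERIV_half_flow]) (auto intro!: derivative_eq_intros)
  then show ?thesis using assms True by (auto simp: flow_def)
next
  case False
  have "((\<lambda>t. 1 - half_flow (hit_time (1 - x) + t)) has_real_derivative
      vel (1 - half_flow (hit_time (1 - x) + t))) (at t)"
    by (auto simp: vel_reflect intro!: derivative_eq_intros DERIV_chain2[OF DERIV_half_flow])
  then show ?thesis using assms False by (auto simp: flow_def)
qed

text \<open>The inner function \<open>hit_time x + t\<close> contributes the factor 1 / v(x). So the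
  Jacobian of the flow is the ratio of the velocities at the two ends of the trajectory: a field is
  transported by its own flow.\<close>

lemma DERIV_flow_space:
  assumes "x \<in> noknot"
  shows "(flow t has_real_derivative vel (flow t x) / vel x) (at x)"
proof (cases "x < 1/2")
  case True
  with assms have x: "x \<in> {0<..<1/2}" by auto
  have "((\<lambda>x. half_flow (hit_time x + t)) has_real_derivative vel (half_flow (hit_time x + t)) * (1 / vel x)) (at x)"
    by (rule DERIV_chain2[OF DERIV_half_flow]) (auto intro!: derivative_eq_intros DERIV_hit_time x)
  then have "((\<lambda>x. half_flow (hit_time x + t)) has_real_derivative vel (flow t x) / vel x) (at x)"
    using x by (simp add: flow_def)
  then show ?thesis
    by (rule has_field_derivative_transform_within_open[where S = "{0<..<1/2}"])
      (use x in \<open>auto simp: flow_def\<close>)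
next
  case False
  with assms have x: "x \<in> {1/2<..<1}" by auto
  have "((\<lambda>x. hit_time (1 - x)) has_real_derivative (1 / vel (1 - x)) * (-1)) (at x)"
    by (rule DERIV_chain2[OF DERIV_hit_time]) (use x in \<open>auto intro!: derivative_eq_intros\<close>)
  then have "((\<lambda>x. 1 - half_flow (hit_time (1 - x) + t)) has_real_derivative vel (flow t x) / vel x) (at x)"
    using x by (auto simp: flow_def vel_reflect intro!: derivative_eq_intros DERIV_chain2[OF DERIV_half_flow])
  then show ?thesis
    by (rule has_field_derivative_transform_within_open[where S = "{1/2<..<1}"])
      (use x in \<open>auto simp: flow_def\<close>)
qed

lemma flow_inverse: "flow (-t) (flow t x) = x"
proof -
  consider "x \<in> {0<..<1/2}" | "x \<in> {1/2<..<1}" | "x \<notin> noknot" by blast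
  then show ?thesis
  proof cases
    case 1
    then show ?thesis using half_flow_in[of "hit_time x + t"] half_flow_hit_time[of x] by (simp add: flow_def)
  next
    case 2
    then show ?thesis using half_flow_in[of "hit_time (1 - x) + t"] half_flow_hit_time[of "1 - x"]
      by (simp add: flow_def)
  next
    case 3
    then have "flow s x = x" for s by (auto simp: flow_def)
    then show ?thesis by simp
  qed
qed

lemma flow_inverse': "flow t (flow (-t) x) = x"
  using flow_inverse[of "-t" x] by simp

text \<open>At the three zeros of the field, \<open>jac\<close> takes the limit values; \<open>q_geo\<close> is \<open>0\<close> there, by
  division by zero.\<close>

definition jac :: "real \<Rightarrow> real \<Rightarrow> real" where
  "jac t x = (if x \<in> noknot then vel (flow t x) / vel x else if x = 1/2 then exp (- t / 2) else 1)"

text \<open>The spatial derivative of the logarithm of the Jacobian, i.e. the second derivative of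
  the flow over the first.\<close>

definition q_geo :: "real \<Rightarrow> real \<Rightarrow> real" where
  "q_geo t x = (dvel (flow t x) - dvel x) / vel x"

definition p_geo :: "real \<Rightarrow> real \<Rightarrow> real" where
  "p_geo t x = ddvel (flow t x)"

lemma borel_measurable_jac [measurable]: "(\<lambda>(t, x). jac t x) \<in> borel_measurable (borel \<Otimes>\<^sub>M borel)"
  unfolding jac_def[abs_def] by measurable

lemma borel_measurable_q_geo [measurable]: "(\<lambda>(t, x). q_geo t x) \<in> borel_measurable (borel \<Otimes>\<^sub>M borel)"
  unfolding q_geo_def[abs_def] by measurable

lemma borel_measurable_p_geo [measurable]: "(\<lambda>(t, x). p_geo t x) \<in> borel_measurable (borel \<Otimes>\<^sub>M borel)"
  unfolding p_geo_def[abs_def] by measurable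

section \<open>Positivity and derivatives of the Jacobian, and time derivatives of the
  geodesic\<close>

lemma vel_neg: "x \<in> {1/2<..<1} \<Longrightarrow> vel x < 0"
  by (auto simp: vel_def mult_less_0_iff)

lemma vel_nonzero: "x \<in> noknot \<Longrightarrow> vel x \<noteq> 0"
  using vel_pos[of x] vel_neg[of x] by auto

lemma vel_knot: "vel 0 = 0" "vel (1/2) = 0" "vel 1 = 0"
  by (auto simp: vel_def)

lemma jac_pos: "0 < jac t x"
proof -
  consider "x \<in> {0<..<1/2}" | "x \<in> {1/2<..<1}" | "x \<notin> noknot" by blast
  then show ?thesis
  proof cases
    case 1
    then show ?thesis using vel_pos[OF 1] vel_pos[OF flow_left[OF 1, of t]] by (simp add: jac_def)
  next
    case 2
    then show ?thesis using vel_neg[OF 2] vel_neg[OF flow_right[OF 2, of t]] by (auto simp: jac_def divide_neg_neg)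
  qed (auto simp: jac_def)
qed

lemma jac_knot [simp]: "jac t 0 = 1" "jac t 1 = 1" "jac t (1/2) = exp (- t / 2)"
  by (auto simp: jac_def)

lemma jac_zero: "jac 0 x = 1"
  using vel_nonzero[of x] by (auto simp: jac_def)

lemma jac_reflect: "jac t (1 - x) = jac t x"
proof -
  consider "x < 1/2" | "x = 1/2" | "1/2 < x" by linarith
  then show ?thesis
  proof cases
    case 2
    show ?thesis unfolding 2 by simp
  qed (simp_all add: jac_def flow_reflect vel_reflect)
qed

lemma DERIV_jac_time:
  assumes "x \<in> noknot"
  shows "((\<lambda>t. jac t x) has_real_derivative dvel (flow t x) * jac t x) (at t)"
proof -
  have "((\<lambda>t. vel (flow t x) / vel x) has_real_derivative dvel (flow t x) * vel (flow t x) / vel x) (at t)"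
    using DERIV_chain2[OF DERIV_vel DERIV_flow_time[OF assms]] vel_nonzero[OF assms]
    by (auto intro!: derivative_eq_intros)
  then show ?thesis using assms by (simp add: jac_def)
qed

lemma DERIV_jac_space:
  assumes "x \<in> noknot"
  shows "(jac t has_real_derivative q_geo t x * jac t x) (at x)"
proof -
  have nz: "vel x \<noteq> 0" "vel (flow t x) \<noteq> 0"
    using vel_nonzero flow_noknot assms by auto
  have "((\<lambda>x. vel (flow t x) / vel x) has_real_derivative q_geo t x * jac t x) (at x)"
    using DERIV_chain2[OF DERIV_vel DERIV_flow_space[OF assms, of t]] DERIV_vel[of x] nz assms
    by (auto intro!: derivative_eq_intros simp: q_geo_def jac_def field_simps)
  then show ?thesis
    by (rule has_field_derivative_transform_within_open[where S = noknot])
      (use assms in \<open>auto simp: jac_def\<close>)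
qed

lemma DERIV_flow_space':
  "x \<in> noknot \<Longrightarrow> (flow t has_real_derivative jac t x) (at x)"
  using DERIV_flow_space[of x t] by (simp add: jac_def)

lemma DERIV_ln_jac_time:
  "x \<in> noknot \<Longrightarrow> ((\<lambda>t. ln (jac t x)) has_real_derivative dvel (flow t x)) (at t)"
  using DERIV_jac_time[of x t] jac_pos[of t x]
  by (auto intro!: derivative_eq_intros)

lemma DERIV_ln_jac_space:
  "x \<in> noknot \<Longrightarrow> ((\<lambda>x. ln (jac t x)) has_real_derivative q_geo t x) (at x)"
  using DERIV_jac_space[of x t] jac_pos[of t x]
  by (auto intro!: derivative_eq_intros)

lemma DERIV_p_geo_time:
  assumes "x \<in> noknot"
  shows "((\<lambda>t. p_geo t x) has_real_derivative -12 * vel (flow t x)) (at t)"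
  unfolding p_geo_def
  using flow_noknot[OF assms, of t]
  by (intro DERIV_chain2[OF DERIV_ddvel DERIV_flow_time[OF assms]]) auto

text \<open>The relation q' = \<eta> p for the geodesic: along a trajectory \<open>dvel\<close>
  changes at the rate \<open>ddvel\<close> times \<open>vel\<close>, and the quotient of the
  velocities is the Jacobian.\<close>

lemma DERIV_q_geo_time:
  assumes "x \<in> noknot"
  shows "((\<lambda>t. q_geo t x) has_real_derivative p_geo t x * jac t x) (at t)"
proof -
  have "flow t x \<noteq> 1/2" using flow_noknot[OF assms, of t] by auto
  then have "((\<lambda>t. q_geo t x) has_real_derivative ddvel (flow t x) * vel (flow t x) / vel x) (at t)"
    unfolding q_geo_def
    using DERIV_chain2[OF DERIV_dvel DERIV_flow_time[OF assms], of t] vel_nonzero[OF assms]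
    by (auto intro!: derivative_eq_intros)
  then show ?thesis using assms by (simp add: jac_def p_geo_def)
qed

section \<open>Bounds on the field and along trajectories\<close>

lemma vel_bound:
  assumes "x \<in> {0..1}"
  shows "\<bar>vel x\<bar> \<le> 1"
proof -
  have *: "z\<^sup>2 * \<bar>1 - 2 * x\<bar> \<le> 1" if "z \<in> {0..1}" for z
    by (rule mult_le_one) (use assms that in \<open>auto simp: abs_le_iff power_le_one\<close>)
  show ?thesis using *[of x] *[of "1 - x"] assms by (auto simp: vel_def abs_mult)
qed

lemma dvel_bound: "x \<in> {0..1} \<Longrightarrow> \<bar>dvel x\<bar> \<le> 1/2"
proof -
  have *: "\<bar>2 * y - 6 * y\<^sup>2\<bar> \<le> 1/2" if "y \<in> {0..1/2}" for y :: real
  proof -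
    have "0 \<le> (y - 1/6)\<^sup>2" by simp
    \<comment> \<open>Factorization of 1/2 + 2 y - 6 y^2: the minimum -1/2 of \<open>dvel\<close> is
      attained at the knot.\<close>
    moreover have "0 \<le> (1/2 - y) * (6 * y + 1)" using that by (intro mult_nonneg_nonneg) auto
    ultimately have "2 * y - 6 * y\<^sup>2 \<le> 1/2" "- (2 * y - 6 * y\<^sup>2) \<le> 1/2"
      by (simp_all add: power2_eq_square algebra_simps)
    then show ?thesis by linarith
  qed
  show "x \<in> {0..1} \<Longrightarrow> \<bar>dvel x\<bar> \<le> 1/2" using *[of x] *[of "1 - x"] by (auto simp: dvel_def)
qed

lemma ddvel_bound: "x \<in> {0..1} \<Longrightarrow> \<bar>ddvel x\<bar> \<le> 4"
  by (auto simp: ddvel_def)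

lemma p_geo_bound: "x \<in> {0..1} \<Longrightarrow> \<bar>p_geo t x\<bar> \<le> 4"
  unfolding p_geo_def by (intro ddvel_bound flow_in)

text \<open>The time derivative of ln \<open>jac\<close> is \<open>dvel\<close> along the
  trajectory, so it can be compared with a constant rate \<open>c\<close>. The rate is 0 near the
  endpoints and for the global bound, and -1/2, the value of \<open>dvel\<close> at the knot, near
  the knot.\<close>

lemma abs_ln_jac_le:
  assumes "x \<in> noknot" "0 \<le> t"
    and "\<And>s. s \<in> {0..t} \<Longrightarrow> \<bar>dvel (flow s x) - c\<bar> \<le> K"
  shows "\<bar>ln (jac t x) - c * t\<bar> \<le> K * t"
proof -
  have "norm ((ln (jac t x) - c * t) - (ln (jac 0 x) - c * 0)) \<le> K * norm (t - 0)"
  proof (rule field_differentiable_bound[where S = "{0..t}" and f' = "\<lambda>s. dvel (flow s x) - c"])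
    fix s
    have "((\<lambda>t. ln (jac t x) - c * t) has_real_derivative dvel (flow s x) - c * 1) (at s)"
      by (intro DERIV_diff DERIV_cmult DERIV_ident DERIV_ln_jac_time assms)
    then show "((\<lambda>t. ln (jac t x) - c * t) has_real_derivative dvel (flow s x) - c) (at s within {0..t})"
      by (simp add: has_field_derivative_at_within)
  qed (use assms in auto)
  then show ?thesis using assms by (simp add: jac_zero)
qed

lemma jac_bound:
  assumes "x \<in> {0..1}" "0 \<le> t"
  shows "jac t x \<le> exp (t / 2)"
proof (cases "x \<in> noknot")
  case True
  have "\<bar>ln (jac t x) - 0 * t\<bar> \<le> 1/2 * t"
    using dvel_bound[OF flow_in[OF assms(1)]] by (intro abs_ln_jac_le[OF True assms(2)]) auto
  then have "ln (jac t x) \<le> t / 2" by simp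
  then show ?thesis using jac_pos[of t x] by (metis exp_le_cancel_iff exp_ln)
next
  case False
  then show ?thesis using assms by (auto simp: jac_def)
qed

lemma flow_ge: "x \<in> {0<..<1/2} \<Longrightarrow> 0 \<le> t \<Longrightarrow> x \<le> flow t x"
proof -
  assume x: "x \<in> {0<..<1/2}" and t: "0 \<le> t"
  have "flow 0 x \<le> flow t x"
  proof (rule DERIV_nonneg_imp_nondecreasing[OF t])
    fix s assume "0 \<le> s" "s \<le> t"
    show "\<exists>y. ((\<lambda>t. flow t x) has_real_derivative y) (at s) \<and> 0 \<le> y"
      using DERIV_flow_time[of x s] x vel_pos[OF flow_left[OF x, of s]] by (auto intro!: exI)
  qed
  then show ?thesis by simp
qed

text \<open>Gronwall's argument from v(y) \<le> y. Trajectories leave the zero 0, and this controls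
  how far they get in a given time, linearly in the starting point.\<close>

lemma flow_le: "x \<in> {0<..<1/2} \<Longrightarrow> 0 \<le> t \<Longrightarrow> flow t x \<le> x * exp t"
proof -
  assume x: "x \<in> {0<..<1/2}" and t: "0 \<le> t"
  have "flow t x * exp (-t) \<le> flow 0 x * exp (-0)"
  proof (rule DERIV_nonpos_imp_nonincreasing[OF t])
    fix s assume "0 \<le> s" "s \<le> t"
    define y where "y = flow s x"
    have y: "0 < y" "y < 1/2" using flow_left[OF x, of s] by (auto simp: y_def)
    have "vel y = y * (y * (1 - 2 * y))" using y by (simp add: vel_def power2_eq_square)
    also have "\<dots> \<le> y * 1" using y by (intro mult_left_mono mult_le_one) auto
    finally have "vel y \<le> y" by simp
    moreover have "((\<lambda>t. flow t x * exp (-t)) has_real_derivative (vel y - y) * exp (-s)) (at s)"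
      using DERIV_flow_time[of x s] x unfolding y_def
      by (auto intro!: derivative_eq_intros simp: algebra_simps)
    ultimately show "\<exists>z. ((\<lambda>t. flow t x * exp (-t)) has_real_derivative z) (at s) \<and> z \<le> 0"
      by (meson diff_le_0_iff_le exp_ge_zero mult_nonpos_nonneg)
  qed
  then show ?thesis by (simp add: exp_minus field_simps)
qed

section \<open>Continuity at the zeros of the field\<close>

lemma continuous_within_if_bound:
  fixes f :: "real \<Rightarrow> real"
  assumes "\<And>x. x \<in> S \<Longrightarrow> \<bar>f x - f a\<bar> \<le> C * \<bar>x - a\<bar>"
  shows "continuous (at a within S) f"
proof -
  have "((\<lambda>x. f x - f a) \<longlongrightarrow> 0) (at a within S)"
  proof (rule Lim_null_comparison)
    show "\<forall>\<^sub>F x in at a within S. norm (f x - f a) \<le> C * \<bar>x - a\<bar>"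
      using assms by (auto simp: eventually_at_filter)
    show "((\<lambda>x. C * \<bar>x - a\<bar>) \<longlongrightarrow> 0) (at a within S)"
      by (auto intro!: tendsto_eq_intros)
  qed
  then show ?thesis by (simp add: continuous_within LIM_zero_iff)
qed

text \<open>At 0 and 1/2 the closed formulas degenerate, so continuity there is deduced from linear
  estimates on the left half alone. The functional equation under x -> 1 - x carries it to the right
  half.\<close>

lemma continuous_on_unit_interval_reflect:
  fixes f :: "real \<Rightarrow> real"
  assumes zero: "\<And>x. x \<in> {0<..<1/2} \<Longrightarrow> \<bar>f x - f 0\<bar> \<le> C * x"
    and half: "\<And>x. x \<in> {0<..<1/2} \<Longrightarrow> \<bar>f x - f (1/2)\<bar> \<le> D * (1/2 - x)"
    and inner: "\<And>x. x \<in> {0<..<1/2} \<Longrightarrow> isCont f x"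
    and reflect: "\<And>x. x \<in> {1/2..1} \<Longrightarrow> f x = g (f (1 - x))"
    and g: "continuous_on UNIV g"
  shows "continuous_on {0..1} f"
proof -
  have "continuous (at x within {0..1/2}) f" if "x \<in> {0..1/2}" for x
  proof -
    from that consider "x = 0" | "x = 1/2" | "x \<in> {0<..<1/2}" by fastforce
    then show ?thesis
    proof cases
      case 1
      \<comment> \<open>The second entry of the maximum handles the opposite endpoint y = 1/2, which
        the hypothesis leaves out; there |y - 0| = 1/2.\<close>
      have "\<bar>f y - f 0\<bar> \<le> max C (\<bar>f (1/2) - f 0\<bar> * 2) * \<bar>y - 0\<bar>" if "y \<in> {0..1/2}" for y
      proof -
        from that consider "y = 0" | "y = 1/2" | "y \<in> {0<..<1/2}" by fastforce
        then show ?thesis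
        proof cases
          case 2
          show ?thesis unfolding 2 by simp
        next
          case 3
          have "\<bar>f y - f 0\<bar> \<le> C * y" by (rule zero[OF 3])
          also have "\<dots> \<le> max C (\<bar>f (1/2) - f 0\<bar> * 2) * y" using 3 by (intro mult_right_mono) auto
          finally show ?thesis using 3 by simp
        qed simp
      qed
      then show ?thesis unfolding 1 by (rule continuous_within_if_bound)
    next
      case 2
      have "\<bar>f y - f (1/2)\<bar> \<le> max D (\<bar>f 0 - f (1/2)\<bar> * 2) * \<bar>y - 1/2\<bar>" if "y \<in> {0..1/2}" for y
      proof -
        from that consider "y = 1/2" | "y = 0" | "y \<in> {0<..<1/2}" by fastforce
        then show ?thesis
        proof cases
          case 1
          show ?thesis unfolding 1 by simp
        next
          case 3
          have "\<bar>f y - f (1/2)\<bar> \<le> D * (1/2 - y)" by (rule half[OF 3])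
          also have "\<dots> \<le> max D (\<bar>f 0 - f (1/2)\<bar> * 2) * (1/2 - y)" using 3 by (intro mult_right_mono) auto
          finally show ?thesis using 3 by simp
        qed simp
      qed
      then show ?thesis unfolding 2 by (rule continuous_within_if_bound)
    next
      case 3
      then show ?thesis using inner continuous_at_imp_continuous_at_within by blast
    qed
  qed
  then have left: "continuous_on {0..1/2} f" by (simp add: continuous_on_eq_continuous_within)
  have "continuous_on {1/2..1} (\<lambda>x. g (f (1 - x)))"
    by (rule continuous_on_compose2[OF g], rule continuous_on_compose2[OF left]) (auto intro!: continuous_intros)
  then have right: "continuous_on {1/2..1} f"
    by (rule continuous_on_eq) (simp add: reflect)
  have "{0..1} = {0..1/2} \<union> {1/2..1::real}" by auto
  then show ?thesis using continuous_on_closed_Un[OF _ _ left right] by simp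
qed

lemma continuous_on_flow:
  assumes "0 \<le> t"
  shows "continuous_on {0..1} (flow t)"
proof (rule continuous_on_unit_interval_reflect)
  fix x :: real assume x: "x \<in> {0<..<1/2}"
  show "\<bar>flow t x - flow t 0\<bar> \<le> exp t * x"
    using flow_le[OF x assms] flow_left[OF x, of t] by (simp add: mult.commute)
  show "\<bar>flow t x - flow t (1/2)\<bar> \<le> 1 * (1/2 - x)"
    using flow_ge[OF x assms] flow_left[OF x, of t] by simp
  show "isCont (flow t) x"
    using x by (intro DERIV_isCont[OF DERIV_flow_space]) auto
next
  show "flow t x = 1 - flow t (1 - x)" for x by (simp add: flow_reflect)
qed (intro continuous_intros)

text \<open>\<open>jac\<close> is 0/0 at a zero of the field, but its logarithm is the time integral
  of \<open>dvel\<close> along a trajectory. A trajectory starting near 0 stays within x exp t of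
  it, and one on the left half only approaches the knot, so \<open>dvel\<close> stays linearly close
  to its value at the zero in question.\<close>

lemma continuous_on_ln_jac:
  assumes "0 \<le> t"
  shows "continuous_on {0..1} (\<lambda>x. ln (jac t x))"
proof (rule continuous_on_unit_interval_reflect)
  fix x :: real assume x: "x \<in> {0<..<1/2}"
  have "\<bar>ln (jac t x) - 0 * t\<bar> \<le> 2 * (x * exp t) * t"
  proof (rule abs_ln_jac_le)
    fix s assume s: "s \<in> {0..t}"
    define y where "y = flow s x"
    have y: "0 < y" "y < 1/2" using flow_left[OF x, of s] by (auto simp: y_def)
    have "y \<le> x * exp s" using flow_le[OF x] s by (simp add: y_def)
    also have "\<dots> \<le> x * exp t" using x s by simp
    finally have "y \<le> x * exp t" .
    moreover have "dvel y = 2 * y * (1 - 3 * y)" using y by (simp add: dvel_def power2_eq_square algebra_simps)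
    then have "\<bar>dvel y\<bar> = 2 * y * \<bar>1 - 3 * y\<bar>" using y by (simp add: abs_mult)
    moreover have "2 * y * \<bar>1 - 3 * y\<bar> \<le> 2 * y * 1" using y by (intro mult_left_mono) auto
    ultimately show "\<bar>dvel (flow s x) - 0\<bar> \<le> 2 * (x * exp t)" by (simp add: y_def)
  qed (use x assms in auto)
  then show "\<bar>ln (jac t x) - ln (jac t 0)\<bar> \<le> (2 * exp t * t) * x" by (simp add: mult_ac)
  have "\<bar>ln (jac t x) - (-1/2) * t\<bar> \<le> 4 * (1/2 - x) * t"
  proof (rule abs_ln_jac_le)
    fix s assume s: "s \<in> {0..t}"
    define y where "y = flow s x"
    have y: "0 < y" "y < 1/2" "x \<le> y" using flow_left[OF x, of s] flow_ge[OF x, of s] s by (auto simp: y_def)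
    have "dvel y - (-1/2) = (1/2 - y) * (6 * y + 1)" using y by (simp add: dvel_def power2_eq_square algebra_simps)
    moreover have "0 \<le> (1/2 - y) * (6 * y + 1)" using y by simp
    moreover have "(1/2 - y) * (6 * y + 1) \<le> (1/2 - x) * 4" using y by (intro mult_mono) auto
    ultimately show "\<bar>dvel (flow s x) - (-1/2)\<bar> \<le> 4 * (1/2 - x)" by (simp add: y_def)
  qed (use x assms in auto)
  then show "\<bar>ln (jac t x) - ln (jac t (1/2))\<bar> \<le> (4 * t) * (1/2 - x)" by (simp add: mult_ac)
  show "isCont (\<lambda>x. ln (jac t x)) x"
    using x by (intro DERIV_isCont[OF DERIV_ln_jac_space]) auto
next
  show "ln (jac t x) = ln (jac t (1 - x))" for x by (simp add: jac_reflect)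
qed (rule continuous_on_id)

lemma continuous_on_jac:
  assumes "0 \<le> t"
  shows "continuous_on {0..1} (jac t)"
proof -
  have "continuous_on {0..1} (\<lambda>x. exp (ln (jac t x)))"
    by (intro continuous_intros continuous_on_ln_jac[OF assms])
  then show ?thesis using jac_pos[of t] by simp
qed

text \<open>The defining quotient gives no bound near the zeros of \<open>vel\<close>. Since it
  vanishes at time 0, integrating its time derivative p times \<open>jac\<close> does.\<close>

lemma q_geo_bound:
  assumes "x \<in> {0..1}" "0 \<le> t"
  shows "\<bar>q_geo t x\<bar> \<le> 4 * exp (t / 2) * t"
proof (cases "x \<in> noknot")
  case True
  have "norm (q_geo t x - q_geo 0 x) \<le> (4 * exp (t / 2)) * norm (t - 0)"
  proof (rule field_differentiable_bound[where S = "{0..t}" and f' = "\<lambda>s. p_geo s x * jac s x"])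
    fix s assume s: "s \<in> {0..t}"
    have "jac s x \<le> exp (s / 2)" using s jac_bound[OF assms(1)] by simp
    also have "\<dots> \<le> exp (t / 2)" using s by simp
    finally show "norm (p_geo s x * jac s x) \<le> 4 * exp (t / 2)"
      using p_geo_bound[OF assms(1), of s] jac_pos[of s x] by (auto simp: abs_mult intro!: mult_mono)
  qed (use assms True in \<open>auto intro!: has_field_derivative_at_within DERIV_q_geo_time\<close>)
  then show ?thesis using assms by (simp add: q_geo_def)
next
  case False
  then consider "x = 0" | "x = 1/2" | "x = 1" using assms by fastforce
  then have "vel x = 0" by cases (simp_all only: vel_knot)
  then show ?thesis using assms by (simp add: q_geo_def)
qed

text \<open>Boundedness gives Lebesgue integrability at once, so the value can be taken from the
  gauge integral, whose fundamental theorem tolerates a finite exceptional set. In the applications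
  that set is the knot or empty.\<close>

lemma LINT_FTC:
  fixes F f :: "real \<Rightarrow> real"
  assumes "a \<le> b" "finite S" and F: "continuous_on {a..b} F"
    and F': "\<And>x. x \<in> {a<..<b} - S \<Longrightarrow> (F has_real_derivative f x) (at x)"
    and f: "f \<in> borel_measurable borel" "\<And>x. x \<in> {a..b} \<Longrightarrow> \<bar>f x\<bar> \<le> B"
  shows "set_integrable lborel {a..b} f" "(LINT x:{a..b}|lborel. f x) = F b - F a"
proof -
  show int: "set_integrable lborel {a..b} f"
    unfolding set_integrable_def
    by (rule integrableI_bounded_set_indicator[where B = B])
      (use f in \<open>auto simp: emeasure_lborel_Icc_eq\<close>)
  have "(f has_integral (F b - F a)) {a..b}"
    by (rule fundamental_theorem_of_calculus_interior_strong[OF assms(2,1) _ F])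
      (use F' in \<open>auto simp: has_real_derivative_iff_has_vector_derivative\<close>)
  then show "(LINT x:{a..b}|lborel. f x) = F b - F a"
    using set_borel_integral_eq_integral(2)[OF int] by (simp add: integral_unique)
qed

section \<open>Integrals along the flow\<close>

lemma LINT_I01: "(LINT x|I01. f x) = (LINT x:{0..1}|lborel. f x)" for f :: "real \<Rightarrow> real"
  unfolding set_lebesgue_integral_def by (rule integral_restrict_space) simp

lemma integrable_I01: "integrable I01 f \<longleftrightarrow> set_integrable lborel {0..1} f" for f :: "real \<Rightarrow> real"
  unfolding set_integrable_def by (rule integrable_restrict_space) simp

lemma borel_measurable_I01: "f \<in> borel_measurable borel \<Longrightarrow> f \<in> borel_measurable I01"
  by (rule measurable_restrict_space1) simp

lemma space_I01 [simp]: "space I01 = {0..1}"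
  by (simp add: space_restrict_space)

lemma AE_I01: "(AE x in I01. P x) \<longleftrightarrow> (AE x in lborel. x \<in> {0..1} \<longrightarrow> P x)"
  by (rule AE_restrict_space_iff) simp

lemma AE_I01_noknot: "AE x in I01. x \<in> noknot"
proof -
  have "AE x in lborel. x \<notin> {0, 1/2, 1::real}"
    by (rule AE_not_in) (auto simp: null_sets_def emeasure_lborel_countable)
  then show ?thesis
    unfolding AE_I01 by eventually_elim auto
qed

lemma L2_01_bounded:
  assumes "f \<in> borel_measurable borel" "\<And>x. x \<in> {0..1} \<Longrightarrow> \<bar>f x\<bar> \<le> B"
  shows "f \<in> L2_01"
proof -
  have "integrable I01 (\<lambda>x. (f x)\<^sup>2)"
    unfolding integrable_I01 set_integrable_def
  proof (rule integrableI_bounded_set_indicator[where B = "B\<^sup>2"])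
    show "AE x in lborel. x \<in> {0..1} \<longrightarrow> norm ((f x)\<^sup>2) \<le> B\<^sup>2"
      using assms(2) power_mono[of "\<bar>f x\<bar>" B 2 for x] by auto
  qed (use assms(1) in auto)
  then show ?thesis unfolding L2_01_def using borel_measurable_I01[OF assms(1)] by simp
qed

text \<open>Continuity of ln \<open>jac\<close> allows integration across the knot, and
  \<open>jac t 0 = 1\<close> makes the integration constant vanish.\<close>

lemma eta_q_geo:
  assumes "x \<in> {0..1}" "0 \<le> t"
  shows "eta (q_geo t) x = jac t x"
proof -
  have "(LINT u:{0..x}|lborel. q_geo t u) = ln (jac t x) - ln (jac t 0)"
  proof (rule LINT_FTC(2)[where S = "{1/2}"])
    show "continuous_on {0..x} (\<lambda>x. ln (jac t x))"
      by (rule continuous_on_subset[OF continuous_on_ln_jac]) (use assms in auto)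
    show "\<bar>q_geo t y\<bar> \<le> 4 * exp (t / 2) * t" if "y \<in> {0..x}" for y
      using that assms by (intro q_geo_bound) auto
  qed (use assms in \<open>auto intro!: DERIV_ln_jac_space\<close>)
  then show ?thesis using jac_pos[of t x] by (simp add: eta_def)
qed

text \<open>The substitution y = \<open>flow t x\<close>, done by differentiating F along the flow.
  Since the flow fixes the knot, a jump of f at 1/2 produces only the exceptional point 1/2 in x as
  well.\<close>

lemma LINT_flow_substitution:
  assumes "0 \<le> t" "0 \<le> a" "a \<le> b" "b \<le> 1"
    and F: "continuous_on {0..1} F" "\<And>y. y \<in> noknot \<Longrightarrow> (F has_real_derivative f y) (at y)"
    and f: "f \<in> borel_measurable borel" "\<And>y. y \<in> {0..1} \<Longrightarrow> \<bar>f y\<bar> \<le> B"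
  shows "(LINT x:{a..b}|lborel. f (flow t x) * jac t x) = F (flow t b) - F (flow t a)"
proof (rule LINT_FTC(2)[where S = "{1/2}"])
  show "continuous_on {a..b} (\<lambda>x. F (flow t x))"
    by (rule continuous_on_compose2[OF F(1) continuous_on_subset[OF continuous_on_flow]])
      (use assms flow_in[of _ t] in auto)
  show "((\<lambda>x. F (flow t x)) has_real_derivative f (flow t x) * jac t x) (at x)"
    if "x \<in> {a<..<b} - {1/2}" for x
    using that assms by (intro DERIV_chain2[OF F(2) DERIV_flow_space'] flow_noknot) auto
  show "(\<lambda>x. f (flow t x) * jac t x) \<in> borel_measurable borel"
    using f(1) by measurable
  show "\<bar>f (flow t x) * jac t x\<bar> \<le> B * exp (t / 2)" if "x \<in> {a..b}" for x
  proof -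
    have x: "x \<in> {0..1}" using that assms by auto
    show ?thesis unfolding abs_mult
      using f(2)[OF flow_in[OF x, of t]] jac_bound[OF x assms(1)] jac_pos[of t x]
      by (intro mult_mono) auto
  qed
qed (use assms in auto)

lemma phi_q_geo:
  assumes "x \<in> {0..1}" "0 \<le> t"
  shows "phi (q_geo t) x = flow t x"
proof -
  have "phi (q_geo t) x = (LINT y:{0..x}|lborel. 1 * jac t y)"
    unfolding phi_def using assms by (intro set_lebesgue_integral_cong) (auto simp: eta_q_geo)
  also have "\<dots> = flow t x - flow t 0"
    by (rule LINT_flow_substitution[where f = "\<lambda>_. 1" and B = 1]) (use assms in \<open>auto intro!: continuous_intros\<close>)
  finally show ?thesis by simp
qed

lemma the_inv_into_phi_q_geo:
  assumes "y \<in> {0..1}" "0 \<le> t"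
  shows "the_inv_into {0..1} (phi (q_geo t)) y = flow (-t) y"
proof (rule the_inv_into_f_eq)
  show "inj_on (phi (q_geo t)) {0..1}"
    by (rule inj_on_inverseI[where g = "flow (-t)"]) (use assms in \<open>simp add: phi_q_geo flow_inverse\<close>)
qed (use assms flow_in[of y "-t"] in \<open>auto simp: phi_q_geo flow_inverse'\<close>)

lemma LINT_eta_flow:
  assumes "0 \<le> t" "0 \<le> a" "a \<le> 1"
    and F: "continuous_on {0..1} F" "\<And>y. y \<in> noknot \<Longrightarrow> (F has_real_derivative f y) (at y)"
    and f: "f \<in> borel_measurable borel" "\<And>y. y \<in> {0..1} \<Longrightarrow> \<bar>f y\<bar> \<le> B"
    and g: "\<And>x. x \<in> {a..1} \<Longrightarrow> g x = f (flow t x)"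
  shows "(LINT x:{a..1}|lborel. eta (q_geo t) x * g x) = F 1 - F (flow t a)"
proof -
  have "(LINT x:{a..1}|lborel. eta (q_geo t) x * g x) = (LINT x:{a..1}|lborel. f (flow t x) * jac t x)"
    by (intro set_lebesgue_integral_cong) (use assms(1-3) in \<open>auto simp: eta_q_geo g\<close>)
  also have "\<dots> = F (flow t 1) - F (flow t a)"
    by (rule LINT_flow_substitution[OF _ _ _ _ F f]) (use assms(1-3) in auto)
  finally show ?thesis by simp
qed

text \<open>In the variable y = \<phi>(x) the weight \<eta> disappears, and the pairings with 1 and
  \<phi> become the plain moments of f of order 0 and 1, which do not depend on time.\<close>

lemma inner_eta_one:
  assumes "0 \<le> t"
    and F: "continuous_on {0..1} F" "\<And>y. y \<in> noknot \<Longrightarrow> (F has_real_derivative f y) (at y)"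
    and f: "f \<in> borel_measurable borel" "\<And>y. y \<in> {0..1} \<Longrightarrow> \<bar>f y\<bar> \<le> B"
    and g: "\<And>x. x \<in> {0..1} \<Longrightarrow> g x = f (flow t x)"
  shows "inner_eta (q_geo t) g (\<lambda>_. 1) = F 1 - F 0"
proof -
  have "inner_eta (q_geo t) g (\<lambda>_. 1) = (LINT x:{0..1}|lborel. eta (q_geo t) x * g x)"
    unfolding inner_eta_def LINT_I01 by (intro set_lebesgue_integral_cong) auto
  also have "\<dots> = F 1 - F (flow t 0)"
    by (rule LINT_eta_flow[OF _ _ _ F f g]) (use assms(1) in auto)
  finally show ?thesis by simp
qed

lemma inner_eta_phi:
  assumes "0 \<le> t"
    and F: "continuous_on {0..1} F" "\<And>y. y \<in> noknot \<Longrightarrow> (F has_real_derivative f y * y) (at y)"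
    and f: "f \<in> borel_measurable borel" "\<And>y. y \<in> {0..1} \<Longrightarrow> \<bar>f y\<bar> \<le> B"
    and g: "\<And>x. x \<in> {0..1} \<Longrightarrow> g x = f (flow t x)"
  shows "inner_eta (q_geo t) g (phi (q_geo t)) = F 1 - F 0"
proof -
  have "inner_eta (q_geo t) g (phi (q_geo t)) = (LINT x:{0..1}|lborel. eta (q_geo t) x * (g x * flow t x))"
    unfolding inner_eta_def LINT_I01
    by (intro set_lebesgue_integral_cong) (use assms(1) in \<open>auto simp: phi_q_geo\<close>)
  also have "\<dots> = F 1 - F (flow t 0)"
  proof (rule LINT_eta_flow[OF _ _ _ F, where B = "B * 1"])
    show "\<bar>f y * y\<bar> \<le> B * 1" if "y \<in> {0..1}" for y
      using f(2)[OF that] that unfolding abs_mult by (intro mult_mono) auto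
  qed (use assms(1) f(1) g in auto)
  finally show ?thesis by simp
qed

section \<open>Antiderivatives of the field, and the constraints on position and momentum\<close>

definition int_vel :: "real \<Rightarrow> real" where
  "int_vel x = (if x \<le> 1/2 then x ^ 3 / 3 - x ^ 4 / 2 else (1 - x) ^ 3 / 3 - (1 - x) ^ 4 / 2)"

text \<open>The constant 1/240 is twice the value at the knot and makes the branches match. As the
  value at 1 it determines the first moment -1/240 of the field.\<close>

definition int2_vel :: "real \<Rightarrow> real" where
  "int2_vel x = (if x \<le> 1/2 then x ^ 4 / 12 - x ^ 5 / 10 else 1/240 - (1 - x) ^ 4 / 12 + (1 - x) ^ 5 / 10)"

lemma DERIV_int_vel: "(int_vel has_real_derivative vel x) (at x)"
  unfolding int_vel_def[abs_def] vel_def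
  by (rule DERIV_glue) (auto intro!: derivative_eq_intros simp: eval_nat_numeral field_simps)

lemma DERIV_int2_vel: "(int2_vel has_real_derivative int_vel x) (at x)"
  unfolding int2_vel_def[abs_def] int_vel_def
  by (rule DERIV_glue) (auto intro!: derivative_eq_intros simp: eval_nat_numeral field_simps)

lemma continuous_on_int_vel: "continuous_on A int_vel"
  using DERIV_int_vel DERIV_isCont continuous_at_imp_continuous_on by blast

lemma continuous_on_int2_vel: "continuous_on A int2_vel"
  using DERIV_int2_vel DERIV_isCont continuous_at_imp_continuous_on by blast

lemma q_geo_measurable: "q_geo t \<in> borel_measurable borel"
  by measurable

lemma p_geo_measurable: "p_geo t \<in> borel_measurable borel"
  by measurable

lemma vel_unit: "vel 0 = 0" "vel 1 = 0" "dvel 0 = 0" "dvel 1 = 0" "int_vel 0 = 0" "int_vel 1 = 0"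
  "int2_vel 0 = 0" "int2_vel 1 = 1/240"
  by (simp_all add: vel_def dvel_def int_vel_def int2_vel_def)

text \<open>The two constraints say that the flow has unit Jacobian at 1 and fixes 1, which follows
  from v' = 0 and v = 0 at that end.\<close>

lemma q_geo_in_Q_space:
  assumes "0 \<le> t"
  shows "q_geo t \<in> Q_space"
proof -
  have "q_geo t \<in> L2_01"
    by (rule L2_01_bounded[OF q_geo_measurable q_geo_bound[OF _ assms]])
  moreover have "(LINT x|I01. q_geo t x) = ln (eta (q_geo t) 1)"
    by (simp add: LINT_I01 eta_def)
  moreover have "(LINT x|I01. eta (q_geo t) x) = phi (q_geo t) 1"
    by (simp add: LINT_I01 phi_def)
  ultimately show ?thesis using assms by (simp add: Q_space_def eta_q_geo phi_q_geo)
qed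

text \<open>The moments of v'' are the boundary terms of v' and of y v' - v. They vanish because v =
  v' = 0 at both ends.\<close>

lemma p_geo_in_cotangent:
  assumes "0 \<le> t"
  shows "p_geo t \<in> cotangent (q_geo t)"
proof -
  have "p_geo t \<in> L2_01"
    by (rule L2_01_bounded[OF p_geo_measurable p_geo_bound])
  moreover have "inner_eta (q_geo t) (p_geo t) (\<lambda>_. 1) = dvel 1 - dvel 0"
    by (rule inner_eta_one[OF assms continuous_on_dvel, where f = ddvel and B = 4])
      (auto simp: p_geo_def ddvel_bound intro!: DERIV_dvel)
  moreover have "inner_eta (q_geo t) (p_geo t) (phi (q_geo t)) = (1 * dvel 1 - vel 1) - (0 * dvel 0 - vel 0)"
  proof (rule inner_eta_phi[OF assms, where f = ddvel and B = 4])
    show "continuous_on {0..1} (\<lambda>y. y * dvel y - vel y)"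
      by (intro continuous_intros continuous_on_dvel continuous_on_vel)
    show "((\<lambda>y. y * dvel y - vel y) has_real_derivative ddvel y * y) (at y)" if "y \<in> noknot" for y
    proof -
      have "y \<noteq> 1/2" using that by auto
      then show ?thesis by (auto intro!: derivative_eq_intros DERIV_dvel DERIV_vel)
    qed
  qed (auto simp: p_geo_def ddvel_bound)
  ultimately show ?thesis by (simp add: cotangent_def vel_unit)
qed

section \<open>The geodesic equation\<close>

lemma matrix_inv_H2_mat: "matrix_inv H2_mat = vector [vector [4, -6], vector [-6, 12]]"
proof -
  define B :: "real ^ 2 ^ 2" where "B = vector [vector [4, -6], vector [-6, 12]]"
  have B: "H2_mat ** B = mat 1" "B ** H2_mat = mat 1"
    by (simp_all add: vec_eq_iff forall_2 matrix_matrix_mult_def sum_2 mat_def H2_mat_def B_def)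
  have "H2_mat ** matrix_inv H2_mat = mat 1"
    unfolding matrix_inv_def by (rule someI2[of _ B]) (simp_all add: B)
  then have "B ** (H2_mat ** matrix_inv H2_mat) = B" by simp
  then show ?thesis by (simp add: matrix_mul_assoc B flip: B_def)
qed

lemma span_comb_eq: "span_comb q (vector [a, b]) x = (4 * a - 6 * b) + (12 * b - 6 * a) * phi q x"
  by (simp add: span_comb_def matrix_inv_H2_mat matrix_vector_mult_def inner_vec_def sum_2 algebra_simps)

lemma span_comb_scale: "span_comb q (vector [c * a, c * b]) x = c * span_comb q (vector [a, b]) x"
  by (simp add: span_comb_eq algebra_simps)

lemma inner_eta_scale: "inner_eta q (\<lambda>x. c * f x) g = c * inner_eta q f g"
  by (simp add: inner_eta_def mult.assoc)

lemma pi_star_scale: "pi_star q (\<lambda>x. c * f x) x = c * pi_star q f x"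
  by (simp add: pi_star_def inner_eta_scale span_comb_scale right_diff_distrib)

lemma U_fun_scale: "U_fun (\<lambda>y. c * f y) q x = c * U_fun f q x"
  by (simp add: U_fun_def mult.left_commute[of _ c])

lemma b_coef_scale: "b_coef (\<lambda>x. c * p x) q = c\<^sup>2 * b_coef p q"
  by (simp add: b_coef_def power_mult_distrib)

text \<open>Every term of the covariant derivative other than the time derivative of p is quadratic
  in p. A change of speed therefore rescales the old covariant derivative by k^2 and adds only the
  acceleration along p.\<close>

lemma covar_flat_reparametrize:
  "covar_flat (\<lambda>x. c * p x + k\<^sup>2 * a x) (\<lambda>x. k * p x) q x = c * p x + k\<^sup>2 * covar_flat a p q x"
proof -
  have U: "U_fun (\<lambda>y. (k * p y)\<^sup>2) q = (\<lambda>x. k\<^sup>2 * U_fun (\<lambda>y. (p y)\<^sup>2) q x)"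
    by (simp add: fun_eq_iff power_mult_distrib U_fun_scale)
  show ?thesis
    unfolding covar_flat_def U b_coef_scale pi_star_scale
    using span_comb_scale[of q "k\<^sup>2" 0 "b_coef p q" x]
    by (simp add: algebra_simps)
qed

lemma U_fun_p_geo:
  assumes "x \<in> {0..1}" "0 \<le> t"
  shows "U_fun (\<lambda>y. (p_geo t y)\<^sup>2) (q_geo t) x = 2 - 2 * flow t x + 12 * vel (flow t x)"
proof -
  have "(LINT y:{x..1}|lborel. eta (q_geo t) y * (p_geo t y)\<^sup>2)
      = (4 * 1 - 24 * vel 1) - (4 * flow t x - 24 * vel (flow t x))"
  proof (rule LINT_eta_flow[where f = "\<lambda>y. (ddvel y)\<^sup>2" and B = "4\<^sup>2"])
    show "((\<lambda>y. 4 * y - 24 * vel y) has_real_derivative (ddvel y)\<^sup>2) (at y)" for y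
      unfolding ddvel_sq by (auto intro!: derivative_eq_intros DERIV_vel)
    show "\<bar>(ddvel y)\<^sup>2\<bar> \<le> 4\<^sup>2" if "y \<in> {0..1}" for y
      using power_mono[OF ddvel_bound[OF that], of 2] by simp
  qed (use assms in \<open>auto simp: p_geo_def intro!: continuous_intros continuous_on_vel\<close>)
  then show ?thesis by (simp add: U_fun_def vel_unit)
qed

text \<open>An antiderivative of (v')^2; the constant 1/30 is twice the value at the knot.\<close>

definition int_dvel_sq :: "real \<Rightarrow> real" where
  "int_dvel_sq x = (if x \<le> 1/2 then 4/3 * x ^ 3 - 6 * x ^ 4 + 36/5 * x ^ 5
     else 1/30 - (4/3 * (1 - x) ^ 3 - 6 * (1 - x) ^ 4 + 36/5 * (1 - x) ^ 5))"

lemma DERIV_int_dvel_sq: "(int_dvel_sq has_real_derivative (dvel x)\<^sup>2) (at x)"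
proof -
  have "(dvel x)\<^sup>2 = (if x \<le> 1/2 then (2 * x - 6 * x\<^sup>2)\<^sup>2 else (2 * (1 - x) - 6 * (1 - x)\<^sup>2)\<^sup>2)"
    by (simp add: dvel_def)
  then show ?thesis
    unfolding int_dvel_sq_def[abs_def]
    by (simp only:, intro DERIV_glue)
      (auto intro!: derivative_eq_intros simp: eval_nat_numeral field_simps)
qed

text \<open>Composition with the inverse of \<phi> turns p into v'', whose integral from 0 is v'. So
  the coefficient is 3/2 times the integral 1/30 of (v')^2.\<close>

lemma b_coef_geo:
  assumes "0 \<le> t"
  shows "b_coef (p_geo t) (q_geo t) = 1/20"
proof -
  have inner: "(LINT y:{0..x}|lborel. p_geo t (the_inv_into {0..1} (phi (q_geo t)) y)) = dvel x"
    if "x \<in> {0..1}" for x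
  proof -
    have "(LINT y:{0..x}|lborel. p_geo t (the_inv_into {0..1} (phi (q_geo t)) y)) = (LINT y:{0..x}|lborel. ddvel y)"
      using that assms
      by (intro set_lebesgue_integral_cong) (auto simp: the_inv_into_phi_q_geo p_geo_def flow_inverse')
    also have "\<dots> = dvel x - dvel 0"
      by (rule LINT_FTC(2)[where S = "{1/2}" and B = 4])
        (use that in \<open>auto intro!: continuous_on_dvel DERIV_dvel ddvel_bound\<close>)
    finally show ?thesis by (simp add: vel_unit)
  qed
  have "(LINT x|I01. (LINT y:{0..x}|lborel. p_geo t (the_inv_into {0..1} (phi (q_geo t)) y))\<^sup>2)
      = (LINT x:{0..1}|lborel. (dvel x)\<^sup>2)"
    unfolding LINT_I01 by (intro set_lebesgue_integral_cong) (auto simp: inner)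
  also have "\<dots> = int_dvel_sq 1 - int_dvel_sq 0"
  proof (rule LINT_FTC(2)[where S = "{}" and B = "(1/2)\<^sup>2"])
    show "continuous_on {0..1} int_dvel_sq"
      using DERIV_int_dvel_sq DERIV_isCont continuous_at_imp_continuous_on by blast
    show "\<bar>(dvel y)\<^sup>2\<bar> \<le> (1/2)\<^sup>2" if "y \<in> {0..1}" for y
      using power_mono[OF dvel_bound[OF that], of 2] by simp
  qed (auto intro!: DERIV_int_dvel_sq)
  finally show ?thesis by (simp add: b_coef_def int_dvel_sq_def)
qed

text \<open>The term -12 v cancels the field part of U and leaves 2 - 2 \<phi>. The first moment of
  U is 1/3 - 1/20, and the coefficient b = 1/20 restores 1/3, so the total affine correction has
  moments 1 and 1/3 and is again 2 - 2 \<phi>.\<close>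

lemma covar_flat_geo:
  assumes "x \<in> {0..1}" "0 \<le> t"
  shows "covar_flat (\<lambda>x. -12 * vel (flow t x)) (p_geo t) (q_geo t) x = 0"
proof -
  let ?U = "U_fun (\<lambda>y. (p_geo t y)\<^sup>2) (q_geo t)"
  let ?f = "\<lambda>y. 2 - 2 * y + 12 * vel y"
  have f: "\<bar>?f y\<bar> \<le> 16" if "y \<in> {0..1}" for y
    using vel_bound[OF that] that by auto
  have "inner_eta (q_geo t) ?U (\<lambda>_. 1) = (2 * 1 - 1\<^sup>2 + 12 * int_vel 1) - (2 * 0 - 0\<^sup>2 + 12 * int_vel 0)"
    by (rule inner_eta_one[OF assms(2), where f = ?f and B = 16])
      (auto intro!: continuous_intros continuous_on_int_vel derivative_eq_intros DERIV_int_vel f simp: U_fun_p_geo assms(2))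
  then have one: "inner_eta (q_geo t) ?U (\<lambda>_. 1) = 1" by (simp add: vel_unit)
  have "inner_eta (q_geo t) ?U (phi (q_geo t))
      = (1\<^sup>2 - 2/3 * 1 ^ 3 + 12 * (1 * int_vel 1 - int2_vel 1))
        - (0\<^sup>2 - 2/3 * 0 ^ 3 + 12 * (0 * int_vel 0 - int2_vel 0))"
  proof (rule inner_eta_phi[OF assms(2), where f = ?f and B = 16])
    show "continuous_on {0..1} (\<lambda>y. y\<^sup>2 - 2/3 * y ^ 3 + 12 * (y * int_vel y - int2_vel y))"
      by (intro continuous_intros continuous_on_int_vel continuous_on_int2_vel)
    show "((\<lambda>y. y\<^sup>2 - 2/3 * y ^ 3 + 12 * (y * int_vel y - int2_vel y)) has_real_derivative ?f y * y) (at y)" for y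
      by (auto intro!: derivative_eq_intros DERIV_int_vel DERIV_int2_vel simp: algebra_simps power2_eq_square)
  qed (auto simp: f U_fun_p_geo assms(2))
  then have phi: "inner_eta (q_geo t) ?U (phi (q_geo t)) = 1/3 - 1/20" by (simp add: vel_unit)
  show ?thesis
    using assms
    by (simp add: covar_flat_def pi_star_def one phi b_coef_geo span_comb_eq U_fun_p_geo phi_q_geo algebra_simps)
qed

section \<open>Differentiability in the sense of L2\<close>

lemma measure_I01 [simp]: "emeasure I01 {0..1} = 1" "measure I01 {0..1} = 1"
  by (simp_all add: emeasure_restrict_space measure_restrict_space)

lemma finite_measure_I01: "finite_measure I01"
  by (rule finite_measureI) simp

lemma L2_norm_le:
  assumes "\<And>x. x \<in> noknot \<Longrightarrow> \<bar>f x\<bar> \<le> B" "0 \<le> B"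
  shows "L2_norm f \<le> B"
proof -
  interpret finite_measure I01 by (rule finite_measure_I01)
  have "(LINT x|I01. (f x)\<^sup>2) \<le> (LINT x|I01. B\<^sup>2)"
  proof (rule integral_mono_AE')
    show "AE x in I01. (f x)\<^sup>2 \<le> B\<^sup>2"
      using AE_I01_noknot
    proof eventually_elim
      case (elim x)
      show ?case using power_mono[OF assms(1)[OF elim], of 2] by simp
    qed
  qed auto
  then have "(LINT x|I01. (f x)\<^sup>2) \<le> B\<^sup>2" by simp
  then show ?thesis unfolding L2_norm_def using real_sqrt_le_mono assms(2) by fastforce
qed

text \<open>A bounded second time derivative makes the difference quotients converge uniformly off
  the zeros, at the rate M |s - t|. Times are cut off at t + 1 because the bounds for the geodesic
  grow with time.\<close>

lemma has_L2_derivative_bounded: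
  assumes "0 \<le> t"
    and u: "\<And>x s. x \<in> noknot \<Longrightarrow> s \<in> {0..t + 1} \<Longrightarrow> ((\<lambda>s. u s x) has_real_derivative v s x) (at s)"
    and v: "\<And>x s. x \<in> noknot \<Longrightarrow> s \<in> {0..t + 1} \<Longrightarrow> ((\<lambda>s. v s x) has_real_derivative w s x) (at s)"
    and w: "\<And>x s. x \<in> noknot \<Longrightarrow> s \<in> {0..t + 1} \<Longrightarrow> \<bar>w s x\<bar> \<le> M"
    and v': "\<And>x. x \<in> noknot \<Longrightarrow> v' x = v t x"
  shows "has_L2_derivative u v' t {0..}"
proof -
  have M: "0 \<le> M" using w[of "1/4" 0] assms(1) by auto
  have bound: "L2_norm (\<lambda>x. (u s x - u t x) / (s - t) - v' x) \<le> M * \<bar>s - t\<bar>"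
    if s: "s \<in> {0..t + 1}" "s \<noteq> t" for s
  proof (rule L2_norm_le)
    fix x assume x: "x \<in> noknot"
    have v_lip: "\<bar>v r x - v t x\<bar> \<le> M * \<bar>s - t\<bar>" if r: "r \<in> {min s t..max s t}" for r
    proof -
      have "norm (v r x - v t x) \<le> M * norm (r - t)"
        by (rule field_differentiable_bound[where S = "{0..t + 1}" and f' = "\<lambda>s. w s x"])
          (use v w x s r assms(1) in \<open>auto intro: has_field_derivative_at_within\<close>)
      also have "\<dots> \<le> M * \<bar>s - t\<bar>" using r M by (intro mult_left_mono) auto
      finally show ?thesis by simp
    qed
    \<comment> \<open>Mean value estimate for the remainder of the first-order expansion, whose
      derivative in s is v s x - v t x.\<close>
    have "norm ((u s x - s * v t x) - (u t x - t * v t x)) \<le> (M * \<bar>s - t\<bar>) * norm (s - t)"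
    proof (rule field_differentiable_bound[where S = "{min s t..max s t}" and f' = "\<lambda>r. v r x - v t x"])
      fix r assume r: "r \<in> {min s t..max s t}"
      then have "r \<in> {0..t + 1}" using s assms(1) by auto
      then have "((\<lambda>s. u s x - s * v t x) has_real_derivative v r x - v t x) (at r)"
        using u[OF x] by (auto intro!: derivative_eq_intros)
      then show "((\<lambda>s. u s x - s * v t x) has_real_derivative v r x - v t x) (at r within {min s t..max s t})"
        by (rule has_field_derivative_at_within)
    qed (use v_lip in auto)
    moreover have "(u s x - u t x) / (s - t) - v' x = ((u s x - s * v t x) - (u t x - t * v t x)) / (s - t)"
      using s v'[OF x] by (simp add: field_simps)
    ultimately show "\<bar>(u s x - u t x) / (s - t) - v' x\<bar> \<le> M * \<bar>s - t\<bar>"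
      using s by (simp add: abs_divide divide_le_eq)
  qed (use M in auto)
  show ?thesis
    unfolding has_L2_derivative_def
  proof (rule Lim_null_comparison)
    have "eventually (\<lambda>s. s \<in> {..<t + 1}) (nhds t)"
      by (rule eventually_nhds_in_open) auto
    then show "\<forall>\<^sub>F s in at t within {0..}. norm (L2_norm (\<lambda>x. (u s x - u t x) / (s - t) - v' x)) \<le> M * \<bar>s - t\<bar>"
      unfolding eventually_at_filter
      using bound by (auto elim!: eventually_mono simp: L2_norm_def)
    show "((\<lambda>s. M * \<bar>s - t\<bar>) \<longlongrightarrow> 0) (at t within {0..})"
      by (auto intro!: tendsto_eq_intros)
  qed
qed

lemma geodesic_geo: "geodesic p_geo q_geo"
  unfolding geodesic_def
proof (intro allI impI conjI)
  fix t :: real assume t: "0 \<le> t"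
  show "q_geo t \<in> Q_space" by (rule q_geo_in_Q_space[OF t])
  show "p_geo t \<in> cotangent (q_geo t)" by (rule p_geo_in_cotangent[OF t])
  show "has_L2_derivative q_geo (\<lambda>x. eta (q_geo t) x * p_geo t x) t {0..}"
  proof (rule has_L2_derivative_bounded[OF t])
    fix x s assume x: "x \<in> noknot" and s: "s \<in> {0..t + 1}"
    show "((\<lambda>s. q_geo s x) has_real_derivative p_geo s x * jac s x) (at s)"
      by (rule DERIV_q_geo_time[OF x])
    show "((\<lambda>s. p_geo s x * jac s x) has_real_derivative
        -12 * vel (flow s x) * jac s x + p_geo s x * dvel (flow s x) * jac s x) (at s)"
      by (auto intro!: derivative_eq_intros DERIV_jac_time[OF x] DERIV_p_geo_time[OF x])
    have x': "x \<in> {0..1}" using x by auto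
    have "jac s x \<le> exp (s / 2)" using s jac_bound[OF x'] by simp
    also have "\<dots> \<le> exp ((t + 1) / 2)" using s by simp
    finally have jac: "\<bar>jac s x\<bar> \<le> exp ((t + 1) / 2)" using jac_pos[of s x] by simp
    have "\<bar>-12 * vel (flow s x) + p_geo s x * dvel (flow s x)\<bar>
        \<le> 12 * \<bar>vel (flow s x)\<bar> + \<bar>p_geo s x\<bar> * \<bar>dvel (flow s x)\<bar>"
      by (intro order_trans[OF abs_triangle_ineq]) (simp add: abs_mult)
    also have "\<dots> \<le> 12 * 1 + 4 * (1/2)"
      by (intro add_mono mult_mono) (use vel_bound dvel_bound flow_in[OF x'] p_geo_bound[OF x'] in auto)
    finally have "\<bar>-12 * vel (flow s x) + p_geo s x * dvel (flow s x)\<bar> \<le> 14" by simp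
    then have "\<bar>-12 * vel (flow s x) + p_geo s x * dvel (flow s x)\<bar> * \<bar>jac s x\<bar> \<le> 14 * exp ((t + 1) / 2)"
      using jac by (intro mult_mono) auto
    then show "\<bar>-12 * vel (flow s x) * jac s x + p_geo s x * dvel (flow s x) * jac s x\<bar> \<le> 14 * exp ((t + 1) / 2)"
      by (simp add: left_diff_distrib flip: abs_mult)
  qed (use t in \<open>auto simp: eta_q_geo\<close>)
  have "(\<lambda>x. -12 * vel (flow t x)) \<in> L2_01"
  proof (rule L2_01_bounded)
    show "\<bar>-12 * vel (flow t x)\<bar> \<le> 12" if "x \<in> {0..1}" for x
      using vel_bound[OF flow_in[OF that, of t]] by (simp add: abs_mult)
  qed measurable
  moreover have "has_L2_derivative p_geo (\<lambda>x. -12 * vel (flow t x)) t {0..}"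
  proof (rule has_L2_derivative_bounded[OF t])
    fix x s assume x: "x \<in> noknot" and s: "s \<in> {0..t + 1}"
    show "((\<lambda>s. p_geo s x) has_real_derivative -12 * vel (flow s x)) (at s)"
      by (rule DERIV_p_geo_time[OF x])
    show "((\<lambda>s. -12 * vel (flow s x)) has_real_derivative -12 * (dvel (flow s x) * vel (flow s x))) (at s)"
      by (intro DERIV_cmult DERIV_chain2[OF DERIV_vel] DERIV_flow_time[OF x])
    have "\<bar>dvel (flow s x)\<bar> * \<bar>vel (flow s x)\<bar> \<le> 1/2 * 1"
      by (intro mult_mono) (use x vel_bound dvel_bound flow_in[of x s] in auto)
    then show "\<bar>-12 * (dvel (flow s x) * vel (flow s x))\<bar> \<le> 6"
      by (simp add: abs_mult)
  qed auto
  moreover have "AE x in I01. covar_flat (\<lambda>x. -12 * vel (flow t x)) (p_geo t) (q_geo t) x = 0"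
    using covar_flat_geo[OF _ t] by (intro AE_I2) simp
  ultimately show "\<exists>a\<in>L2_01. has_L2_derivative p_geo a t {0..} \<and> (AE x in I01. covar_flat a (p_geo t) (q_geo t) x = 0)"
    by blast
qed

section \<open>Uniqueness of Sobolev derivatives\<close>

lemma sigma_finite_I01: "sigma_finite_measure I01"
  using finite_measure_I01 by (rule finite_measure.axioms(1))

lemma pair_sigma_finite_I01: "pair_sigma_finite I01 I01"
  using sigma_finite_I01 by (simp add: pair_sigma_finite_def)

lemma borel_measurable_I01_pair:
  assumes "f \<in> borel_measurable (borel \<Otimes>\<^sub>M borel)"
  shows "f \<in> borel_measurable (I01 \<Otimes>\<^sub>M I01)"
proof -
  have [measurable]: "(\<lambda>x. x) \<in> I01 \<rightarrow>\<^sub>M borel"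
    by (rule borel_measurable_I01) simp
  have "(\<lambda>z. (fst z, snd z)) \<in> I01 \<Otimes>\<^sub>M I01 \<rightarrow>\<^sub>M borel \<Otimes>\<^sub>M borel"
    by (intro measurable_Pair measurable_compose[OF measurable_fst] measurable_compose[OF measurable_snd]) auto
  then show ?thesis using measurable_compose[OF _ assms] by simp
qed

lemma H1_curve_C1:
  assumes v: "(\<lambda>(t, x). v t x) \<in> borel_measurable (borel \<Otimes>\<^sub>M borel)"
    and B: "\<And>t x. t \<in> {0..1} \<Longrightarrow> x \<in> {0..1} \<Longrightarrow> \<bar>v t x\<bar> \<le> B"
    and u: "\<And>t. t \<in> {0..1} \<Longrightarrow> u t \<in> L2_01"
    and u': "\<And>t x. t \<in> {0..1} \<Longrightarrow> x \<in> noknot \<Longrightarrow> ((\<lambda>t. u t x) has_real_derivative v t x) (at t)"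
  shows "H1_curve u v"
  unfolding H1_curve_def
proof (intro conjI ballI)
  interpret finite_measure "I01 \<Otimes>\<^sub>M I01"
    by (intro finite_measure_pair_measure finite_measure_I01)
  show m: "(\<lambda>(t, x). v t x) \<in> borel_measurable (I01 \<Otimes>\<^sub>M I01)"
    by (rule borel_measurable_I01_pair[OF v])
  show "integrable (I01 \<Otimes>\<^sub>M I01) (\<lambda>(t, x). (v t x)\<^sup>2)"
  proof (rule integrable_const_bound[where B = "B\<^sup>2"])
    show "(\<lambda>(t, x). (v t x)\<^sup>2) \<in> borel_measurable (I01 \<Otimes>\<^sub>M I01)"
      using borel_measurable_power[OF m, of 2] by (simp add: case_prod_beta)
    have "(v t x)\<^sup>2 \<le> B\<^sup>2" if "t \<in> {0..1}" "x \<in> {0..1}" for t x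
      using power_mono[OF B[OF that], of 2] by simp
    then show "AE z in I01 \<Otimes>\<^sub>M I01. norm (case z of (t, x) \<Rightarrow> (v t x)\<^sup>2) \<le> B\<^sup>2"
      by (intro AE_I2) (auto simp: space_pair_measure)
  qed
  fix t :: real assume t: "t \<in> {0..1}"
  show "u t \<in> L2_01" by (rule u[OF t])
  show "L2_eq (u t) (\<lambda>x. u 0 x + (LINT s:{0..t}|lborel. v s x))"
    unfolding L2_eq_def using AE_I01_noknot
  proof eventually_elim
    case (elim x)
    have "(LINT s:{0..t}|lborel. v s x) = u t x - u 0 x"
    proof (rule LINT_FTC(2)[where S = "{}"])
      show "continuous_on {0..t} (\<lambda>t. u t x)"
        using t elim by (intro continuous_at_imp_continuous_on ballI DERIV_isCont[OF u']) auto
      show "(\<lambda>s. v s x) \<in> borel_measurable borel"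
        using measurable_compose[OF _ v, of "\<lambda>s. (s, x)" borel] by simp
      show "\<bar>v s x\<bar> \<le> B" if "s \<in> {0..t}" for s
        using that t elim by (intro B) auto
    qed (use t elim u' in auto)
    then show ?case by simp
  qed
qed

text \<open>Only rational times are assumed, since that is what survives when countably many null
  sets are merged. Continuity of the indefinite integral extends the hypothesis to all times; the
  positive and negative parts of g then define measures that agree on all half-lines.\<close>

lemma AE_zero_if_LINT_initial_zero:
  fixes g :: "real \<Rightarrow> real"
  assumes g: "set_integrable lborel {0..1} g"
    and zero: "\<And>t. t \<in> {0..1} \<Longrightarrow> t \<in> \<rat> \<Longrightarrow> (LINT s:{0..t}|lborel. g s) = 0"
  shows "AE s in I01. g s = 0"
proof -
  have HK: "g integrable_on {0..1}" by (rule set_borel_integral_eq_integral(1)[OF g])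
  have sub: "set_integrable lborel {a..b} g" if "0 \<le> a" "b \<le> 1" for a b
    by (rule set_integrable_subset[OF g]) (use that in auto)
  have zero': "(LINT s:{0..t}|lborel. g s) = 0" if "t \<in> {0..1}" for t
  proof -
    have "closure ({0<..<1} \<inter> \<rat>) = {0..1::real}"
      using closure_open_Int_superset[of "{0<..<1::real}" "\<rat>"] by (simp add: Rats_closure_real)
    moreover have "integral {0..x} g = 0" if "x \<in> {0<..<1} \<inter> \<rat>" for x
      using zero[of x] that set_borel_integral_eq_integral(2)[OF sub[of 0 x]] by auto
    ultimately have "integral {0..t} g = 0"
      using continuous_constant_on_closure[of "{0<..<1} \<inter> \<rat>" "\<lambda>t. integral {0..t} g" 0 t]
        indefinite_integral_continuous_1[OF HK] that by metis
    then show ?thesis using set_borel_integral_eq_integral(2)[OF sub[of 0 t]] that by auto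
  qed
  define h where "h s = indicator {0..1} s * g s" for s :: real
  have h: "integrable lborel h" using g by (simp add: set_integrable_def h_def[abs_def])
  then have [measurable]: "h \<in> borel_measurable borel" by simp
  have tail: "(LINT s|lborel. h s * indicator {x<..} s) = 0" for x
  proof -
    have "(LINT s|lborel. h s) = 0"
      using zero'[of 1] by (simp add: set_lebesgue_integral_def h_def[abs_def])
    moreover have "(LINT s|lborel. h s * indicator {..x} s) = 0"
    proof -
      have "h s * indicator {..x} s = indicator {0..min x 1} s *\<^sub>R g s" for s
        by (auto simp: h_def indicator_def)
      then have "(LINT s|lborel. h s * indicator {..x} s) = (LINT s:{0..min x 1}|lborel. g s)"
        unfolding set_lebesgue_integral_def by (simp only:)
      then show ?thesis
        using zero'[of "min x 1"] set_lebesgue_integral_def[of lborel "{}" g] by (cases "0 \<le> x") auto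
    qed
    moreover have "h s * indicator {x<..} s = h s - h s * indicator {..x} s" for s
      by (auto simp: indicator_def)
    moreover have "integrable lborel (\<lambda>s. h s * indicator {..x} s)"
      using integrable_mult_indicator[of "{..x}" lborel h] h by (simp add: mult.commute)
    ultimately show ?thesis using h by simp
  qed
  \<comment> \<open>\<open>ennreal\<close> sends negative numbers to 0, so these are the measures
    whose densities are the positive and the negative part of h. Equality of the two parts forces h
    = 0.\<close>
  have "density lborel (\<lambda>s. ennreal (h s)) = density lborel (\<lambda>s. ennreal (- h s))"
  proof (rule measure_eqI_lessThan)
    fix x :: real
    have int: "integrable lborel (\<lambda>s. h s * indicator {x<..} s)"
      using integrable_mult_indicator[of "{x<..}" lborel h] h by (simp add: mult.commute)
    have pos: "(\<integral>\<^sup>+ s. ennreal (h s * indicator {x<..} s) \<partial>lborel) < \<infinity>"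
      and neg: "(\<integral>\<^sup>+ s. ennreal (- (h s * indicator {x<..} s)) \<partial>lborel) < \<infinity>"
      using int unfolding real_integrable_def by (auto simp: top.not_eq_extremum)
    have e: "emeasure (density lborel (\<lambda>s. ennreal (h s))) {x<..} = (\<integral>\<^sup>+ s. ennreal (h s * indicator {x<..} s) \<partial>lborel)"
      "emeasure (density lborel (\<lambda>s. ennreal (- h s))) {x<..} = (\<integral>\<^sup>+ s. ennreal (- (h s * indicator {x<..} s)) \<partial>lborel)"
      by (auto simp: emeasure_density indicator_def intro!: nn_integral_cong)
    show "emeasure (density lborel (\<lambda>s. ennreal (h s))) {x<..} < \<infinity>"
      using pos by (simp add: e)
    have "enn2real (\<integral>\<^sup>+ s. ennreal (h s * indicator {x<..} s) \<partial>lborel)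
        = enn2real (\<integral>\<^sup>+ s. ennreal (- (h s * indicator {x<..} s)) \<partial>lborel)"
      using tail[of x] real_lebesgue_integral_def[OF int] by simp
    then show "emeasure (density lborel (\<lambda>s. ennreal (h s))) {x<..} = emeasure (density lborel (\<lambda>s. ennreal (- h s))) {x<..}"
      unfolding e using pos neg by (metis ennreal_enn2real infinity_ennreal_def)
  qed auto
  then have "AE s in lborel. ennreal (h s) = ennreal (- h s)"
    by (intro sigma_finite_measure.density_unique[OF sigma_finite_lborel]) auto
  then have "AE s in lborel. h s = 0"
  proof eventually_elim
    case (elim s)
    show ?case
    proof (cases "0 \<le> h s")
      case True
      then have "ennreal (h s) = 0" using elim ennreal_neg[of "- h s"] by simp
      then show ?thesis using True by (simp add: ennreal_eq_0_iff)
    next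
      case False
      then have "ennreal (- h s) = 0" using elim ennreal_neg[of "h s"] by simp
      then show ?thesis using False by (simp add: ennreal_eq_0_iff)
    qed
  qed
  then show ?thesis unfolding AE_I01 by eventually_elim (auto simp: h_def)
qed

lemma H1_curve_integrable:
  assumes "H1_curve u v"
  shows "integrable (I01 \<Otimes>\<^sub>M I01) (\<lambda>(t, x). v t x)"
proof -
  interpret finite_measure "I01 \<Otimes>\<^sub>M I01"
    by (intro finite_measure_pair_measure finite_measure_I01)
  have m: "(\<lambda>(t, x). v t x) \<in> borel_measurable (I01 \<Otimes>\<^sub>M I01)"
    and i: "integrable (I01 \<Otimes>\<^sub>M I01) (\<lambda>(t, x). (v t x)\<^sup>2)"
    using assms by (auto simp: H1_curve_def)
  have "integrable (I01 \<Otimes>\<^sub>M I01) (\<lambda>z. 1 + (case z of (t, x) \<Rightarrow> (v t x)\<^sup>2))"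
    using i by simp
  then show ?thesis
  proof (rule Bochner_Integration.integrable_bound[OF _ m])
    have "\<bar>y\<bar> \<le> 1 + y\<^sup>2" for y :: real
      using zero_le_power2[of "\<bar>y\<bar> - 1"] by (simp add: power2_eq_square algebra_simps)
    then show "AE z in I01 \<Otimes>\<^sub>M I01. norm (case z of (t, x) \<Rightarrow> v t x) \<le> norm (1 + (case z of (t, x) \<Rightarrow> (v t x)\<^sup>2))"
      by (intro AE_I2) (auto simp: case_prod_beta)
  qed
qed

lemma AE_integrable_time_slice:
  fixes v :: "real \<Rightarrow> real \<Rightarrow> real"
  assumes "integrable (I01 \<Otimes>\<^sub>M I01) (\<lambda>(t, x). v t x)"
  shows "AE x in I01. set_integrable lborel {0..1} (\<lambda>t. v t x)"
proof -
  interpret pair_sigma_finite I01 I01 by (rule pair_sigma_finite_I01)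
  have "integrable (I01 \<Otimes>\<^sub>M I01) (\<lambda>(x, t). v t x)"
    using integrable_product_swap[OF assms] by simp
  from AE_integrable_fst'[OF this] show ?thesis by (simp add: integrable_I01)
qed

text \<open>Each time comes with its own null set of x. Restricting to rational times gives one null
  set for all of them; for x outside it the two derivatives agree at almost every t. Joint
  measurability of the set where they agree then permits exchanging the quantifiers. This identifies
  the choice made in \<open>H1_deriv\<close>.\<close>

lemma H1_curve_derivative_unique:
  assumes v: "H1_curve u v" and w: "H1_curve u w"
  shows "AE t in I01. AE x in I01. v t x = w t x"
proof -
  interpret pair_sigma_finite I01 I01 by (rule pair_sigma_finite_I01)
  have iv: "integrable (I01 \<Otimes>\<^sub>M I01) (\<lambda>(t, x). v t x)" by (rule H1_curve_integrable[OF v])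
  have iw: "integrable (I01 \<Otimes>\<^sub>M I01) (\<lambda>(t, x). w t x)" by (rule H1_curve_integrable[OF w])
  have "AE x in I01. u t x = u 0 x + (LINT s:{0..t}|lborel. v s x)
      \<and> u t x = u 0 x + (LINT s:{0..t}|lborel. w s x)" if "t \<in> {0..1} \<inter> \<rat>" for t
    using v w that by (auto simp: H1_curve_def L2_eq_def)
  then have "AE x in I01. \<forall>t\<in>{0..1} \<inter> \<rat>. u t x = u 0 x + (LINT s:{0..t}|lborel. v s x)
      \<and> u t x = u 0 x + (LINT s:{0..t}|lborel. w s x)"
    by (subst AE_ball_countable) (auto intro: countable_Int2 countable_rat)
  with AE_integrable_time_slice[OF iv] AE_integrable_time_slice[OF iw]
  have "AE x in I01. AE t in I01. v t x = w t x"
  proof eventually_elim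
    case (elim x)
    have "AE t in I01. v t x - w t x = 0"
    proof (rule AE_zero_if_LINT_initial_zero)
      show "set_integrable lborel {0..1} (\<lambda>t. v t x - w t x)"
        using elim by (intro set_integral_diff) auto
      fix t :: real assume t: "t \<in> {0..1}" "t \<in> \<rat>"
      have "set_integrable lborel {0..t} (\<lambda>t. v t x)" "set_integrable lborel {0..t} (\<lambda>t. w t x)"
        using elim t by (auto intro: set_integrable_subset)
      then have "(LINT s:{0..t}|lborel. v s x - w s x) = (LINT s:{0..t}|lborel. v s x) - (LINT s:{0..t}|lborel. w s x)"
        by (rule set_integral_diff(2))
      also have "\<dots> = 0" using elim t by force
      finally show "(LINT s:{0..t}|lborel. v s x - w s x) = 0" .
    qed
    then show ?case by eventually_elim simp
  qed
  moreover have "{z \<in> space (I01 \<Otimes>\<^sub>M I01). v (fst z) (snd z) = w (fst z) (snd z)} \<in> sets (I01 \<Otimes>\<^sub>M I01)"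
    using iv iw by (auto simp: case_prod_beta dest!: borel_measurable_integrable intro!: borel_measurable_eq)
  ultimately show ?thesis by (subst AE_commute) auto
qed

lemma AE_H1_deriv:
  assumes "H1_curve u v"
  shows "AE t in I01. AE x in I01. H1_deriv u t x = v t x"
  unfolding H1_deriv_def
  by (rule H1_curve_derivative_unique[OF someI[of "H1_curve u", OF assms] assms])

section \<open>Measures on the line over the knot\<close>

definition line_measure :: "(real \<Rightarrow> real) \<Rightarrow> (real \<times> real) measure" where
  "line_measure g =
     distr (density I01 (\<lambda>t. ennreal (g t))) (restrict_space borel unit_square) (\<lambda>t. (t, 1/2))"

lemma sets_line_measure [measurable_cong]: "sets (line_measure g) = sets (restrict_space borel unit_square)"
  by (simp add: line_measure_def)

lemma space_line_measure [simp]: "space (line_measure g) = unit_square"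
  by (simp add: line_measure_def space_restrict_space)

lemma measurable_line: "(\<lambda>t. (t, 1/2)) \<in> I01 \<rightarrow>\<^sub>M restrict_space borel unit_square"
proof (rule measurable_restrict_space2)
  show "(\<lambda>t. (t, 1/2)) \<in> space I01 \<rightarrow> unit_square" by (auto simp: unit_square_def)
  have "(\<lambda>t. (t, 1/2)) \<in> borel_measurable (borel :: real measure)"
    by (intro borel_measurable_continuous_onI continuous_intros)
  then show "(\<lambda>t. (t, 1/2)) \<in> borel_measurable I01"
    by (intro measurable_restrict_space1) simp
qed

lemma borel_measurable_fst_unit_square:
  "fst \<in> borel_measurable (restrict_space borel unit_square :: (real \<times> real) measure)"
  by (intro borel_measurable_continuous_on_restrict continuous_intros)

lemma nn_integral_line_measure:
  assumes "g \<in> borel_measurable borel" "f \<in> borel_measurable (restrict_space borel unit_square)"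
  shows "(\<integral>\<^sup>+ z. f z \<partial>line_measure g) = (\<integral>\<^sup>+ t. ennreal (g t) * f (t, 1/2) \<partial>I01)"
proof -
  have [measurable]: "g \<in> borel_measurable I01" by (rule borel_measurable_I01[OF assms(1)])
  have [measurable]: "(\<lambda>t. f (t, 1/2)) \<in> borel_measurable I01"
    by (rule measurable_compose[OF measurable_line assms(2)])
  have "(\<integral>\<^sup>+ z. f z \<partial>line_measure g) = (\<integral>\<^sup>+ t. f (t, 1/2) \<partial>density I01 (\<lambda>t. ennreal (g t)))"
    unfolding line_measure_def
    by (rule nn_integral_distr) (use measurable_line assms(2) in auto)
  also have "\<dots> = (\<integral>\<^sup>+ t. ennreal (g t) * f (t, 1/2) \<partial>I01)"
    by (rule nn_integral_density) auto
  finally show ?thesis .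
qed

lemma emeasure_line_measure:
  assumes "g \<in> borel_measurable borel" "A \<in> sets (restrict_space borel unit_square)"
  shows "emeasure (line_measure g) A = (\<integral>\<^sup>+ t. ennreal (g t) * indicator A (t, 1/2) \<partial>I01)"
  using nn_integral_line_measure[OF assms(1), of "indicator A"] assms(2)
  by (simp add: sets_line_measure)

lemma LINT_line_measure:
  fixes f :: "real \<times> real \<Rightarrow> real"
  assumes "g \<in> borel_measurable borel" "\<And>t. t \<in> {0..1} \<Longrightarrow> 0 \<le> g t"
    and "f \<in> borel_measurable (restrict_space borel unit_square)"
  shows "(LINT z|line_measure g. f z) = (LINT t:{0..1}|lborel. g t * f (t, 1/2))"
proof -
  have [measurable]: "g \<in> borel_measurable I01" by (rule borel_measurable_I01[OF assms(1)])
  have [measurable]: "(\<lambda>t. f (t, 1/2)) \<in> borel_measurable I01"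
    by (rule measurable_compose[OF measurable_line assms(3)])
  have "(LINT z|line_measure g. f z) = (LINT t|density I01 (\<lambda>t. ennreal (g t)). f (t, 1/2))"
    unfolding line_measure_def
    by (rule integral_distr) (use measurable_line assms(3) in auto)
  also have "\<dots> = (LINT t|I01. g t *\<^sub>R f (t, 1/2))"
    by (rule integral_density) (use assms(2) in auto)
  finally show ?thesis by (simp add: LINT_I01)
qed

lemma line_measure_in_radon_D:
  assumes "g \<in> borel_measurable borel" "\<And>t. t \<in> {0..1} \<Longrightarrow> g t \<le> C"
  shows "line_measure g \<in> radon_D"
proof -
  have S: "unit_square \<in> sets (restrict_space borel unit_square)"
    using sets.top[of "restrict_space borel unit_square"] by (simp add: space_restrict_space)
  then have "emeasure (line_measure g) unit_square \<le> (\<integral>\<^sup>+ t. ennreal C \<partial>I01)"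
    unfolding emeasure_line_measure[OF assms(1) S]
    using assms(2) by (intro nn_integral_mono) (auto simp: indicator_def intro!: ennreal_leI)
  then have "finite_measure (line_measure g)"
    by (intro finite_measureI) (auto simp: top_unique)
  then show ?thesis by (simp add: radon_D_def sets_line_measure)
qed

text \<open>The reference value at \<Delta> = 0 becomes an instance of the computations for measures
  on the line.\<close>

lemma zero_D_eq_line_measure: "zero_D = line_measure (\<lambda>_. 0)"
  by (rule measure_eqI) (auto simp: zero_D_def sets_line_measure emeasure_line_measure)

lemma AE_line_measure:
  assumes "g \<in> borel_measurable borel" "{z \<in> unit_square. P z} \<in> sets (restrict_space borel unit_square)"
    and "AE t in I01. P (t, 1/2)"
  shows "AE z in line_measure g. P z"
proof -
  have [measurable]: "g \<in> borel_measurable I01" by (rule borel_measurable_I01[OF assms(1)])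
  have "AE t in density I01 (\<lambda>t. ennreal (g t)). P (t, 1/2)"
    using assms(3) by (subst AE_density) auto
  then show ?thesis
    unfolding line_measure_def
    by (subst AE_distr_iff) (use measurable_line assms(2) in \<open>auto simp: space_restrict_space\<close>)
qed

lemma line_measure_time_zero: 
  assumes "g \<in> borel_measurable borel"
  shows "emeasure (line_measure g) ({0} \<times> {0..1}) = 0"
proof -
  have "{0} \<times> {0..1} \<in> sets (restrict_space borel unit_square)"
    by (subst sets_restrict_space_iff) (auto simp: unit_square_def intro!: borel_closed closed_Times)
  moreover have "AE t in I01. ennreal (g t) * indicator ({0} \<times> {0..1::real}) (t, 1/2::real) = 0"
    using AE_I01_noknot by eventually_elim (auto simp: indicator_def)
  then have "(\<integral>\<^sup>+ t. ennreal (g t) * indicator ({0} \<times> {0..1::real}) (t, 1/2::real) \<partial>I01) = 0"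
    by (subst nn_integral_cong_AE[where v = "\<lambda>_. 0"]) auto
  ultimately show ?thesis using assms by (simp add: emeasure_line_measure)
qed

section \<open>The weak time derivative and the initial trace\<close>

lemma test_function_measurable:
  assumes "test_function f f'"
  shows "f \<in> borel_measurable (restrict_space borel unit_square)"
    "f' \<in> borel_measurable (restrict_space borel unit_square)"
  using assms by (auto simp: test_function_def intro!: borel_measurable_continuous_on_restrict)

lemma LINT_zero_D: "f \<in> borel_measurable (restrict_space borel unit_square) \<Longrightarrow> (LINT z|zero_D. f z) = 0"
  for f :: "real \<times> real \<Rightarrow> real"
  by (simp add: zero_D_eq_line_measure LINT_line_measure)

text \<open>Integration by parts in time along the knot. The boundary term vanishes at time 1
  because the test function does, and at time 0 because of the factor t^2.\<close>

lemma weak_time_derivative_line_measure: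
  "weak_time_derivative (line_measure (\<lambda>t. t\<^sup>2)) (line_measure (\<lambda>t. 2 * t), zero_D)"
  unfolding weak_time_derivative_def
proof (intro allI impI)
  fix f f' assume tf: "test_function f f'"
  have cont: "continuous_on {0..1} (\<lambda>t. f (t, 1/2))" "continuous_on {0..1} (\<lambda>t. f' (t, 1/2))"
    by (rule continuous_on_compose2[of unit_square];
        use tf in \<open>auto simp: test_function_def unit_square_def intro!: continuous_intros\<close>)+
  have der: "((\<lambda>t. t\<^sup>2 * f (t, 1/2)) has_real_derivative t\<^sup>2 * f' (t, 1/2) + 2 * t * f (t, 1/2)) (at t within {0..1})"
    if "t \<in> {0..1}" for t
  proof -
    have "((\<lambda>t. f (t, 1/2)) has_real_derivative f' (t, 1/2)) (at t within {0..1})"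
      using tf that by (simp add: test_function_def)
    then show ?thesis by (auto intro!: derivative_eq_intros)
  qed
  have int: "set_integrable lborel {0..1} (\<lambda>t. t\<^sup>2 * f' (t, 1/2))" "set_integrable lborel {0..1} (\<lambda>t. 2 * t * f (t, 1/2))"
    by (intro borel_integrable_atLeastAtMost' continuous_intros cont)+
  have "(LINT z|line_measure (\<lambda>t. t\<^sup>2). f' z) + (LINT z|line_measure (\<lambda>t. 2 * t). f z)
      = (LINT t:{0..1}|lborel. t\<^sup>2 * f' (t, 1/2)) + (LINT t:{0..1}|lborel. 2 * t * f (t, 1/2))"
    using LINT_line_measure[OF _ _ test_function_measurable(2)[OF tf], of "\<lambda>t. t\<^sup>2"]
      LINT_line_measure[OF _ _ test_function_measurable(1)[OF tf], of "\<lambda>t. 2 * t"] by simp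
  also have "\<dots> = (LINT t:{0..1}|lborel. t\<^sup>2 * f' (t, 1/2) + 2 * t * f (t, 1/2))"
    using set_integral_add(2)[OF int] by simp
  also have "\<dots> = integral {0..1} (\<lambda>t. t\<^sup>2 * f' (t, 1/2) + 2 * t * f (t, 1/2))"
    by (rule set_borel_integral_eq_integral(2)[OF set_integral_add(1)[OF int]])
  also have "\<dots> = 1\<^sup>2 * f (1, 1/2) - 0\<^sup>2 * f (0, 1/2)"
    by (rule integral_unique, rule fundamental_theorem_of_calculus)
      (use der in \<open>auto simp: has_real_derivative_iff_has_vector_derivative\<close>)
  also have "\<dots> = 0" using tf by (simp add: test_function_def)
  finally show "(LINT z|line_measure (\<lambda>t. t\<^sup>2). f' z) + signed_integral (line_measure (\<lambda>t. 2 * t), zero_D) f = 0"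
    using test_function_measurable[OF tf] by (simp add: signed_integral_def LINT_zero_D)
qed

text \<open>An approximation of the indicator of t > 0 that is smooth up to t = 0 and vanishes
  there. Being rational, it keeps all derivatives explicit.\<close>

definition cutoff :: "nat \<Rightarrow> real \<Rightarrow> real" where
  "cutoff k t = real k * t / (1 + real k * t)"

lemma cutoff_nonneg:
  assumes "0 \<le> t"
  shows "0 \<le> cutoff k t" "cutoff k t \<le> 1"
proof -
  have "0 \<le> real k * t" using assms by simp
  then show "0 \<le> cutoff k t" "cutoff k t \<le> 1" by (auto simp: cutoff_def divide_le_eq)
qed

lemma cutoff_tendsto: "0 < t \<Longrightarrow> (\<lambda>k. cutoff k t) \<longlonglongrightarrow> 1"
  unfolding cutoff_def by real_asymp

lemma test_function_cutoff:
  assumes "test_function f f'"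
  shows "\<exists>h'. test_function (\<lambda>z. cutoff k (fst z) * f z) h'"
proof -
  have pos: "1 + real k * t \<noteq> 0" if "0 \<le> t" for t :: real
    using that mult_nonneg_nonneg[of "real k" t] by linarith
  have cont: "continuous_on unit_square (\<lambda>z. cutoff k (fst z))"
    "continuous_on unit_square (\<lambda>z. real k / (1 + real k * fst z)\<^sup>2)"
    unfolding cutoff_def using pos by (auto intro!: continuous_intros simp: unit_square_def)
  have der: "(cutoff k has_real_derivative real k / (1 + real k * t)\<^sup>2) (at t within {0..1})" if "0 \<le> t" for t
    unfolding cutoff_def[abs_def] using pos[OF that]
    by (auto intro!: derivative_eq_intros simp: power2_eq_square field_simps)
  have "test_function (\<lambda>z. cutoff k (fst z) * f z)
      (\<lambda>z. real k / (1 + real k * fst z)\<^sup>2 * f z + cutoff k (fst z) * f' z)"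
    unfolding test_function_def
  proof (intro conjI ballI)
    fix t x :: real assume t: "t \<in> {0..1}" and x: "x \<in> {0..1}"
    have "((\<lambda>s. f (s, x)) has_real_derivative f' (t, x)) (at t within {0..1})"
      using assms t x by (simp add: test_function_def)
    from DERIV_mult'[OF der this] t
    show "((\<lambda>s. cutoff k (fst (s, x)) * f (s, x)) has_real_derivative
        real k / (1 + real k * fst (t, x))\<^sup>2 * f (t, x) + cutoff k (fst (t, x)) * f' (t, x)) (at t within {0..1})"
      by (simp add: add.commute)
  next
    show "continuous_on unit_square (\<lambda>z. real k / (1 + real k * fst z)\<^sup>2 * f z + cutoff k (fst z) * f' z)"
      using assms by (intro continuous_on_add continuous_on_mult cont) (auto simp: test_function_def)
  qed (use assms cont in \<open>auto simp: test_function_def intro!: continuous_on_mult\<close>)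
  then show ?thesis by blast
qed

text \<open>Dominated convergence. The limit of the cutoffs is 0 rather than 1 at time 0, so the
  absence of mass there enters.\<close>

lemma cutoff_integral_tendsto:
  assumes \<mu>: "\<mu> \<in> radon_D" "emeasure \<mu> ({0} \<times> {0..1}) = 0" and tf: "test_function f f'"
  shows "(\<lambda>k. LINT z|\<mu>. cutoff k (fst z) * f z) \<longlonglongrightarrow> (LINT z|\<mu>. f z)"
proof -
  interpret finite_measure \<mu> using \<mu>(1) by (simp add: radon_D_def)
  have sets: "sets \<mu> = sets (restrict_space borel unit_square)" using \<mu>(1) by (simp add: radon_D_def)
  then have space: "space \<mu> = unit_square"
    using sets_eq_imp_space_eq[OF sets] by (simp add: space_restrict_space)
  have meas: "h \<in> borel_measurable \<mu>" if "test_function h h'" for h h'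
    using test_function_measurable(1)[OF that] measurable_cong_sets[OF sets refl] by blast
  have "compact (f ` unit_square)"
    using tf by (intro compact_continuous_image) (auto simp: test_function_def unit_square_def intro!: compact_Times)
  then obtain C where C: "\<And>z. z \<in> unit_square \<Longrightarrow> \<bar>f z\<bar> \<le> C"
    using compact_imp_bounded bounded_iff by (metis image_eqI real_norm_def)
  have "{0} \<times> {0..1} \<in> sets \<mu>"
    unfolding sets by (subst sets_restrict_space_iff) (auto simp: unit_square_def intro!: borel_closed closed_Times)
  then have "AE z in \<mu>. z \<notin> {0} \<times> {0..1}"
    using \<mu>(2) by (intro AE_not_in) (auto simp: null_sets_def)
  show ?thesis
  proof (rule integral_dominated_convergence[where w = "\<lambda>_. C"])
    show "(\<lambda>z. cutoff k (fst z) * f z) \<in> borel_measurable \<mu>" for k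
      using test_function_cutoff[OF tf, of k] meas by blast
    show "f \<in> borel_measurable \<mu>" by (rule meas[OF tf])
    show "AE z in \<mu>. (\<lambda>k. cutoff k (fst z) * f z) \<longlonglongrightarrow> f z"
      using \<open>AE z in \<mu>. z \<notin> {0} \<times> {0..1}\<close> AE_space
    proof eventually_elim
      case (elim z)
      then have "0 < fst z" by (cases z) (auto simp: space unit_square_def)
      from tendsto_mult_right[OF cutoff_tendsto[OF this], of "f z"] show ?case by simp
    qed
    show "AE z in \<mu>. norm (cutoff k (fst z) * f z) \<le> C" for k
    proof (rule AE_I2)
      fix z assume "z \<in> space \<mu>"
      then have z: "z \<in> unit_square" "0 \<le> fst z" by (auto simp: space unit_square_def)
      have "\<bar>cutoff k (fst z)\<bar> * \<bar>f z\<bar> \<le> 1 * C"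
        using cutoff_nonneg[OF z(2), of k] C[OF z(1)] by (intro mult_mono) auto
      then show "norm (cutoff k (fst z) * f z) \<le> C" by (simp add: abs_mult)
    qed
  qed auto
qed

text \<open>The cutoff makes every test function vanish at time \<open>0\<close>; comparing with the known derivative
  \<open>d0\<close> in the limit removes the need to estimate the integral of the derivative of the cutoff.\<close>

lemma zero_initial_traceI:
  assumes d0: "weak_time_derivative \<Delta> d0" "d0 \<in> signed_D"
    "emeasure (fst d0) ({0} \<times> {0..1}) = 0" "emeasure (snd d0) ({0} \<times> {0..1}) = 0"
  shows "zero_initial_trace \<Delta>"
  unfolding zero_initial_trace_def
proof (intro ballI impI, elim conjE)
  fix d assume d: "d \<in> signed_D" "emeasure (fst d) ({0} \<times> {0..1}) = 0" "emeasure (snd d) ({0} \<times> {0..1}) = 0"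
    and weak: "\<forall>f f'. test_function f f' \<and> (\<forall>x\<in>{0..1}. f (0, x) = 0) \<longrightarrow> (LINT z|\<Delta>. f' z) + signed_integral d f = 0"
  show "weak_time_derivative \<Delta> d"
    unfolding weak_time_derivative_def
  proof (intro allI impI)
    fix f f' assume tf: "test_function f f'"
    have lim: "(\<lambda>k. signed_integral e (\<lambda>z. cutoff k (fst z) * f z)) \<longlonglongrightarrow> signed_integral e f"
      if "e \<in> signed_D" "emeasure (fst e) ({0} \<times> {0..1}) = 0" "emeasure (snd e) ({0} \<times> {0..1}) = 0" for e
      unfolding signed_integral_def using that
      by (intro tendsto_diff cutoff_integral_tendsto[OF _ _ tf]) (auto simp: signed_D_def)
    have "signed_integral d (\<lambda>z. cutoff k (fst z) * f z) = signed_integral d0 (\<lambda>z. cutoff k (fst z) * f z)" for k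
    proof -
      obtain h' where "test_function (\<lambda>z. cutoff k (fst z) * f z) h'"
        using test_function_cutoff[OF tf] by blast
      moreover have "cutoff k (fst (0, x)) * f (0, x) = 0" for x by (simp add: cutoff_def)
      ultimately have "(LINT z|\<Delta>. h' z) + signed_integral d (\<lambda>z. cutoff k (fst z) * f z) = 0"
        "(LINT z|\<Delta>. h' z) + signed_integral d0 (\<lambda>z. cutoff k (fst z) * f z) = 0"
        using weak d0(1) unfolding weak_time_derivative_def by blast+
      then show ?thesis by simp
    qed
    then have "signed_integral d f = signed_integral d0 f"
      using lim[OF d] lim[OF d0(2-4)] LIMSEQ_unique by simp
    then show "(LINT z|\<Delta>. f' z) + signed_integral d f = 0"
      using d0(1) tf unfolding weak_time_derivative_def by simp
  qed
qed

lemma line_derivative_in_signed_D: "(line_measure (\<lambda>t. 2 * t), zero_D) \<in> signed_D"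
  by (auto simp: signed_D_def zero_D_eq_line_measure intro!: line_measure_in_radon_D[where C = 2])

lemma line_measure_in_M0: "line_measure (\<lambda>t. t\<^sup>2) \<in> M0"
proof -
  have "zero_initial_trace (line_measure (\<lambda>t. t\<^sup>2))"
    by (rule zero_initial_traceI[OF weak_time_derivative_line_measure line_derivative_in_signed_D])
      (auto simp: line_measure_time_zero zero_D_eq_line_measure)
  then show ?thesis
    by (auto simp: M0_def power_le_one intro!: line_measure_in_radon_D[where C = 1])
qed

section \<open>Radon-Nikodym densities and the Fisher-Rao term\<close>

lemma density_line_measure:
  assumes s: "s \<in> borel_measurable borel" and r: "r \<in> borel_measurable borel"
    and g: "g \<in> borel_measurable borel"
    and eq: "\<And>t. t \<in> {0..1} \<Longrightarrow> 0 \<le> s t \<and> 0 \<le> r t \<and> s t * r t = g t"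
  shows "density (line_measure s) (\<lambda>z. ennreal (r (fst z))) = line_measure g"
proof (rule measure_eqI)
  have rm: "(\<lambda>z. ennreal (r (fst z))) \<in> borel_measurable (restrict_space borel unit_square)"
    using measurable_compose[OF borel_measurable_fst_unit_square r] by measurable
  show "sets (density (line_measure s) (\<lambda>z. ennreal (r (fst z)))) = sets (line_measure g)"
    by (simp add: sets_line_measure)
  fix A assume "A \<in> sets (density (line_measure s) (\<lambda>z. ennreal (r (fst z))))"
  then have A: "A \<in> sets (restrict_space borel unit_square)" by (simp add: sets_line_measure)
  then have "emeasure (density (line_measure s) (\<lambda>z. ennreal (r (fst z)))) A
      = (\<integral>\<^sup>+ z. ennreal (r (fst z)) * indicator A z \<partial>line_measure s)"
    using rm by (subst emeasure_density) (auto simp: sets_line_measure cong: measurable_cong_sets)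
  also have "\<dots> = (\<integral>\<^sup>+ t. ennreal (s t) * (ennreal (r t) * indicator A (t, 1/2)) \<partial>I01)"
    using rm A by (subst nn_integral_line_measure[OF s]) auto
  also have "\<dots> = (\<integral>\<^sup>+ t. ennreal (g t) * indicator A (t, 1/2) \<partial>I01)"
    using eq by (intro nn_integral_cong) (auto simp: mult.assoc[symmetric] ennreal_mult[symmetric])
  finally show "emeasure (density (line_measure s) (\<lambda>z. ennreal (r (fst z)))) A = emeasure (line_measure g) A"
    using A by (simp add: emeasure_line_measure[OF g])
qed

lemma dominating_line_measure:
  assumes g: "g \<in> borel_measurable borel" "\<And>t. t \<in> {0..1} \<Longrightarrow> 0 \<le> g t"
    and h: "h \<in> borel_measurable borel" "\<And>t. t \<in> {0..1} \<Longrightarrow> 0 \<le> h t"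
  shows "dominating (line_measure g, zero_D) (line_measure h, zero_D) = line_measure (\<lambda>t. g t + h t)"
proof -
  let ?S = "restrict_space borel unit_square :: (real \<times> real) measure"
  have [measurable]: "g \<in> borel_measurable I01" "h \<in> borel_measurable I01"
    by (rule borel_measurable_I01[OF g(1)], rule borel_measurable_I01[OF h(1)])
  have "measure_of unit_square (sets ?S) (\<lambda>A. emeasure (line_measure g) A + 0 + emeasure (line_measure h) A + 0)
      = measure_of unit_square (sets ?S) (emeasure (line_measure (\<lambda>t. g t + h t)))"
  proof (rule measure_of_eq)
    show "sets ?S \<subseteq> Pow unit_square"
      using sets.space_closed[of ?S] by (simp add: space_restrict_space)
    fix A assume "A \<in> sigma_sets unit_square (sets ?S)"
    then have A: "A \<in> sets ?S"
      using sets.sigma_sets_eq[of ?S] by (simp add: space_restrict_space)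
    have [measurable]: "(\<lambda>t. indicator A (t, 1/2) :: ennreal) \<in> borel_measurable I01"
      by (rule measurable_compose[OF measurable_line]) (use A in measurable)
    have "(\<integral>\<^sup>+ t. ennreal (g t) * indicator A (t, 1/2) \<partial>I01) + (\<integral>\<^sup>+ t. ennreal (h t) * indicator A (t, 1/2) \<partial>I01)
        = (\<integral>\<^sup>+ t. ennreal (g t) * indicator A (t, 1/2) + ennreal (h t) * indicator A (t, 1/2) \<partial>I01)"
      by (rule nn_integral_add[symmetric]) auto
    also have "\<dots> = (\<integral>\<^sup>+ t. ennreal (g t + h t) * indicator A (t, 1/2) \<partial>I01)"
      using g(2) h(2) by (intro nn_integral_cong) (auto simp: ennreal_plus distrib_right)
    finally show "emeasure (line_measure g) A + 0 + emeasure (line_measure h) A + 0 = emeasure (line_measure (\<lambda>t. g t + h t)) A"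
      using A g(1) h(1) by (simp add: emeasure_line_measure)
  qed
  also have "\<dots> = line_measure (\<lambda>t. g t + h t)"
    using measure_of_of_measure[of "line_measure (\<lambda>t. g t + h t)"] by (simp add: sets_line_measure)
  finally show ?thesis by (simp add: dominating_def zero_D_def)
qed

text \<open>For a mass m(t)^2 on the line the Fisher-Rao density is (m')^2 times the weight, so m =
  t costs exactly the integral of the weight. Relative to the dominating density t^2 + 2 t the two
  densities are t / (t + 2) and 2 / (t + 2).\<close>

lemma FR_line_measure:
  assumes f: "f \<in> borel_measurable (restrict_space borel unit_square)"
    and nonneg: "\<And>t. t \<in> {0..1} \<Longrightarrow> 0 \<le> f (t, 1/2)"
  shows "FR f (line_measure (\<lambda>t. t\<^sup>2), zero_D) (line_measure (\<lambda>t. 2 * t), zero_D) = (\<integral>\<^sup>+ t. ennreal (f (t, 1/2)) \<partial>I01)"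
proof -
  let ?S = "restrict_space borel unit_square :: (real \<times> real) measure"
  define lam where "lam = line_measure (\<lambda>t. t\<^sup>2 + 2 * t)"
  have dom: "dominating (line_measure (\<lambda>t. t\<^sup>2), zero_D) (line_measure (\<lambda>t. 2 * t), zero_D) = lam"
    unfolding lam_def by (rule dominating_line_measure) auto
  have "t\<^sup>2 + 2 * t \<le> 3" if "t \<in> {0..1}" for t :: real
    using that power_le_one[of t 2] by simp
  then have "lam \<in> radon_D"
    unfolding lam_def by (intro line_measure_in_radon_D[where C = 3]) auto
  then interpret finite_measure lam by (simp add: radon_D_def)
  note fst = borel_measurable_fst_unit_square
  have RN: "AE z in lam. ennreal (r (fst z)) = RN_deriv lam (line_measure g) z"
    if "r \<in> borel_measurable borel" "g \<in> borel_measurable borel"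
      "\<And>t. t \<in> {0..1} \<Longrightarrow> 0 \<le> r t \<and> (t\<^sup>2 + 2 * t) * r t = g t" for r g
  proof (rule RN_deriv_unique)
    show "density lam (\<lambda>z. ennreal (r (fst z))) = line_measure g"
      unfolding lam_def by (rule density_line_measure) (use that in auto)
    have "(\<lambda>z. ennreal (r (fst z))) \<in> borel_measurable ?S"
      using measurable_compose[OF fst that(1)] by measurable
    then show "(\<lambda>z. ennreal (r (fst z))) \<in> borel_measurable lam"
      by (simp add: lam_def sets_line_measure cong: measurable_cong_sets)
  qed
  have 1: "AE z in lam. ennreal (fst z / (fst z + 2)) = RN_deriv lam (line_measure (\<lambda>t. t\<^sup>2)) z"
    by (rule RN) (auto simp: power2_eq_square field_simps)
  have 2: "AE z in lam. ennreal (2 / (fst z + 2)) = RN_deriv lam (line_measure (\<lambda>t. 2 * t)) z"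
    by (rule RN) (auto simp: power2_eq_square field_simps)
  have 3: "AE z in lam. ennreal 0 = RN_deriv lam zero_D z"
    unfolding zero_D_eq_line_measure by (rule RN) auto
  \<comment> \<open>At time 0 the density of \<Delta> is 0 while that of its derivative is 1, which
    falls into the infinite case of \<open>fr_integrand\<close>.\<close>
  have 4: "AE z in lam. 0 < fst z"
    unfolding lam_def
  proof (rule AE_line_measure)
    have "{z \<in> space ?S. 0 < fst z} \<in> sets ?S" using fst by measurable
    then show "{z \<in> unit_square. 0 < fst z} \<in> sets ?S" by (simp add: space_restrict_space)
    show "AE t in I01. 0 < fst (t, 1/2)" using AE_I01_noknot by eventually_elim auto
  qed auto
  have "FR f (line_measure (\<lambda>t. t\<^sup>2), zero_D) (line_measure (\<lambda>t. 2 * t), zero_D)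
      = (\<integral>\<^sup>+ z. fr_integrand (signed_density lam (line_measure (\<lambda>t. t\<^sup>2), zero_D) z)
          (signed_density lam (line_measure (\<lambda>t. 2 * t), zero_D) z) * ennreal (f z) \<partial>lam)"
    by (simp add: FR_def dom Let_def)
  also have "\<dots> = (\<integral>\<^sup>+ z. ennreal (1 / (fst z * (fst z + 2))) * ennreal (f z) \<partial>lam)"
  proof (rule nn_integral_cong_AE)
    show "AE z in lam. fr_integrand (signed_density lam (line_measure (\<lambda>t. t\<^sup>2), zero_D) z)
          (signed_density lam (line_measure (\<lambda>t. 2 * t), zero_D) z) * ennreal (f z)
        = ennreal (1 / (fst z * (fst z + 2))) * ennreal (f z)"
      using 1 2 3 4
    proof eventually_elim
      case (elim z)
      have d: "signed_density lam (line_measure (\<lambda>t. t\<^sup>2), zero_D) z = fst z / (fst z + 2)"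
        "signed_density lam (line_measure (\<lambda>t. 2 * t), zero_D) z = 2 / (fst z + 2)"
        using elim by (simp_all add: signed_density_def flip: elim(1-3))
      have "1/4 * ((2 / (fst z + 2))\<^sup>2 / (fst z / (fst z + 2))) = 1 / (fst z * (fst z + 2))"
        using elim(4) by (simp add: power2_eq_square divide_simps)
      then show ?case unfolding d fr_integrand_def using elim(4) by simp
    qed
  qed
  also have "\<dots> = (\<integral>\<^sup>+ t. ennreal (t\<^sup>2 + 2 * t) * (ennreal (1 / (t * (t + 2))) * ennreal (f (t, 1/2))) \<partial>I01)"
  proof -
    have "(\<lambda>z. ennreal (1 / (fst z * (fst z + 2))) * ennreal (f z)) \<in> borel_measurable ?S"
      using fst f by measurable
    then show ?thesis unfolding lam_def by (subst nn_integral_line_measure) auto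
  qed
  also have "\<dots> = (\<integral>\<^sup>+ t. ennreal (f (t, 1/2)) \<partial>I01)"
  proof (rule nn_integral_cong_AE)
    show "AE t in I01. ennreal (t\<^sup>2 + 2 * t) * (ennreal (1 / (t * (t + 2))) * ennreal (f (t, 1/2))) = ennreal (f (t, 1/2))"
      using AE_I01_noknot
    proof eventually_elim
      case (elim t)
      then have t: "0 < t" by auto
      have "ennreal (t\<^sup>2 + 2 * t) * ennreal (1 / (t * (t + 2))) = ennreal ((t\<^sup>2 + 2 * t) * (1 / (t * (t + 2))))"
        using t by (intro ennreal_mult[symmetric]) auto
      also have "(t\<^sup>2 + 2 * t) * (1 / (t * (t + 2))) = 1"
        using t add_pos_pos[of "t * t" "t * 2"] by (simp add: power2_eq_square field_simps)
      finally show ?case by (simp add: mult.assoc[symmetric])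
    qed
  qed
  finally show ?thesis .
qed

section \<open>Disintegration and projection\<close>

text \<open>A Dirac mass of weight \<open>c\<close> at the knot.\<close>

definition half_mass :: "real \<Rightarrow> real measure" where
  "half_mass c = distr (density I01 (\<lambda>_. ennreal c)) (restrict_space borel {0..1}) (\<lambda>_. 1/2)"

lemma sets_half_mass: "sets (half_mass c) = sets (restrict_space borel {0..1})"
  by (simp add: half_mass_def)

lemma emeasure_half_mass:
  assumes "X \<in> sets (restrict_space borel {0..1})"
  shows "emeasure (half_mass c) X = ennreal c * indicator X (1/2)"
proof -
  have "(\<lambda>_. 1/2) \<in> density I01 (\<lambda>_. ennreal c) \<rightarrow>\<^sub>M restrict_space borel {0..1::real}"
    by (rule measurable_const) (simp add: space_restrict_space)
  then have "emeasure (half_mass c) X = emeasure (density I01 (\<lambda>_. ennreal c)) ((\<lambda>_. 1/2) -` X \<inter> {0..1})"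
    unfolding half_mass_def using assms by (subst emeasure_distr) auto
  also have "(\<lambda>_. 1/2) -` X \<inter> {0..1} = (if 1/2 \<in> X then {0..1} else {} :: real set)"
    by auto
  finally show ?thesis
    using sets.top[of I01] by (auto simp: emeasure_density_const)
qed

text \<open>Existence of a disintegration ensures that the one chosen in \<open>U_meas\<close>
  satisfies its specification.\<close>

lemma disintegration_line_measure:
  assumes g: "g \<in> borel_measurable borel"
  shows "disintegration (line_measure g) (\<lambda>t. half_mass (g t))"
  unfolding disintegration_def
proof (intro conjI ballI)
  let ?B = "restrict_space borel {0..1} :: real measure"
  fix t :: real
  have "emeasure (half_mass (g t)) {0..1} \<noteq> \<infinity>"
    by (subst emeasure_half_mass) (auto simp: sets_restrict_space_iff)
  then show "finite_measure (half_mass (g t))"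
    by (intro finite_measureI) (simp add: half_mass_def space_restrict_space)
  show "sets (half_mass (g t)) = sets ?B" by (rule sets_half_mass)
next
  let ?B = "restrict_space borel {0..1} :: real measure"
  have [measurable]: "g \<in> borel_measurable I01" by (rule borel_measurable_I01[OF g])
  show "(\<lambda>t. emeasure (half_mass (g t)) B) \<in> borel_measurable I01" if "B \<in> sets ?B" for B
    using that by (simp add: emeasure_half_mass)
  fix A assume "A \<in> sets (line_measure g)"
  then have A: "A \<in> sets (restrict_space borel unit_square)" by (simp add: sets_line_measure)
  show "emeasure (line_measure g) A = (\<integral>\<^sup>+ t. emeasure (half_mass (g t)) (Pair t -` A) \<partial>I01)"
    unfolding emeasure_line_measure[OF g A]
  proof (rule nn_integral_cong)
    fix t assume t: "t \<in> space I01"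
    obtain A' where A': "A' \<in> sets borel" "A = A' \<inter> unit_square"
      using A by (auto simp: sets_restrict_space)
    have "Pair t \<in> borel_measurable borel"
      by (intro borel_measurable_continuous_onI continuous_intros)
    then have "Pair t -` A' \<in> sets borel"
      using measurable_sets_borel[OF _ A'(1)] by blast
    moreover have "Pair t -` A = {0..1} \<inter> Pair t -` A'"
      using t by (auto simp: A'(2) unit_square_def)
    ultimately have "Pair t -` A \<in> sets ?B"
      by (auto simp: sets_restrict_space)
    then show "ennreal (g t) * indicator A (t, 1/2) = emeasure (half_mass (g t)) (Pair t -` A)"
      by (simp add: emeasure_half_mass indicator_def)
  qed
qed

lemma rectangle_in_sets:
  fixes T X :: "real set"
  assumes "T \<in> sets borel" "T \<subseteq> {0..1}" "X \<in> sets borel" "X \<subseteq> {0..1}"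
  shows "T \<times> X \<in> sets (restrict_space borel unit_square)"
proof -
  have "T \<times> X \<in> sets (borel \<Otimes>\<^sub>M borel)" using assms by auto
  then have "T \<times> X \<in> sets borel" by (simp only: borel_prod)
  moreover have "unit_square \<in> sets borel"
    unfolding unit_square_def by (intro borel_closed closed_Times) auto
  ultimately show ?thesis
    by (subst sets_restrict_space_iff) (use assms in \<open>auto simp: unit_square_def\<close>)
qed

text \<open>Testing on rectangles over just two sets, the knot and its complement, shows that almost
  every \<open>K t\<close> has mass g t at 1/2 and none elsewhere. The exceptional null set of times
  is thus the same for all integrands f.\<close>

lemma disintegration_line_measure_unique:
  assumes g: "g \<in> borel_measurable borel" "\<And>t. t \<in> {0..1} \<Longrightarrow> 0 \<le> g t"
    and K: "disintegration (line_measure g) K"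
  shows "AE t in I01. \<forall>f\<in>borel_measurable (restrict_space borel {0..1}). (LINT y|K t. f y) = g t * f (1/2 :: real)"
proof -
  let ?B = "restrict_space borel {0..1} :: real measure"
  let ?N = "{0..1} - {1/2 :: real}"
  interpret I: sigma_finite_measure I01 by (rule sigma_finite_I01)
  have [measurable]: "g \<in> borel_measurable I01" by (rule borel_measurable_I01[OF g(1)])
  have Kt: "finite_measure (K t)" "sets (K t) = sets ?B" if "t \<in> {0..1}" for t
    using K that by (auto simp: disintegration_def)
  have Km: "(\<lambda>t. emeasure (K t) X) \<in> borel_measurable I01" if "X \<in> sets ?B" for X
    using K that by (auto simp: disintegration_def)
  have rect: "(\<integral>\<^sup>+ t. ennreal (g t) * indicator (T \<times> X) (t, 1/2) \<partial>I01) = (\<integral>\<^sup>+ t. emeasure (K t) X * indicator T t \<partial>I01)"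
    if "T \<in> sets borel" "T \<subseteq> {0..1}" "X \<in> sets borel" "X \<subseteq> {0..1}" for T X
  proof -
    note S = rectangle_in_sets[OF that]
    have "(\<integral>\<^sup>+ t. ennreal (g t) * indicator (T \<times> X) (t, 1/2) \<partial>I01) = (\<integral>\<^sup>+ t. emeasure (K t) (Pair t -` (T \<times> X)) \<partial>I01)"
      using K S by (simp add: disintegration_def sets_line_measure flip: emeasure_line_measure[OF g(1) S])
    also have "\<dots> = (\<integral>\<^sup>+ t. emeasure (K t) X * indicator T t \<partial>I01)"
      by (intro nn_integral_cong) (auto simp: indicator_def vimage_def)
    finally show ?thesis .
  qed
  have half: "{1/2} \<in> sets ?B" and N: "?N \<in> sets ?B"
    by (auto simp: sets_restrict_space_iff)
  have "AE t in I01. emeasure (K t) {1/2} = ennreal (g t)"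
  proof (rule I.density_unique2[OF Km[OF half]])
    fix T assume "T \<in> sets I01"
    then have T: "T \<in> sets borel" "T \<subseteq> {0..1}"
      by (auto simp: sets_restrict_space_iff)
    show "(\<integral>\<^sup>+ t\<in>T. emeasure (K t) {1/2} \<partial>I01) = (\<integral>\<^sup>+ t\<in>T. ennreal (g t) \<partial>I01)"
      unfolding rect[OF T, of "{1/2}", simplified, symmetric]
      by (intro nn_integral_cong) (simp add: indicator_def)
  qed auto
  moreover have "AE t in I01. emeasure (K t) ?N = 0"
  proof -
    have "(\<integral>\<^sup>+ t. emeasure (K t) ?N * indicator {0..1} t \<partial>I01) = (\<integral>\<^sup>+ t. 0 \<partial>I01)"
      by (subst rect[symmetric]) (auto simp: indicator_def)
    moreover have "(\<integral>\<^sup>+ t. emeasure (K t) ?N * indicator {0..1} t \<partial>I01) = (\<integral>\<^sup>+ t. emeasure (K t) ?N \<partial>I01)"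
      by (intro nn_integral_cong) simp
    ultimately have "(\<integral>\<^sup>+ t. emeasure (K t) ?N \<partial>I01) = 0" by simp
    then show ?thesis using nn_integral_0_iff_AE[OF Km[OF N]] by simp
  qed
  moreover have "AE t in I01. t \<in> {0..1}" by (rule AE_I2) simp
  ultimately show ?thesis
  proof eventually_elim
    case (elim t)
    interpret finite_measure "K t" by (rule Kt(1)[OF elim(3)])
    have sets: "sets (K t) = sets ?B" by (rule Kt(2)[OF elim(3)])
    then have space: "space (K t) = {0..1}"
      using sets_eq_imp_space_eq[OF sets] by (simp add: space_restrict_space)
    have ae: "AE y in K t. y = 1/2"
      by (rule AE_I[where N = ?N]) (use elim N sets space in auto)
    have "emeasure (K t) {0..1} = emeasure (K t) {1/2} + emeasure (K t) ?N"
      using half N sets by (subst plus_emeasure) (auto intro!: arg_cong2[where f = emeasure])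
    then have "measure (K t) {0..1} = g t"
      using elim g(2)[of t] by (simp add: measure_def)
    then show ?case
    proof (intro ballI)
      fix f :: "real \<Rightarrow> real" assume "f \<in> borel_measurable ?B"
      then have "f \<in> borel_measurable (K t)" using measurable_cong_sets[OF sets refl] by blast
      then have "(LINT y|K t. f y) = (LINT y|K t. f (1/2))"
      proof (intro integral_cong_AE)
        show "AE y in K t. f y = f (1/2)" using ae by eventually_elim (simp only:)
      qed auto
      then show "(LINT y|K t. f y) = g t * f (1/2)"
        using \<open>measure (K t) {0..1} = g t\<close> by (simp add: space)
    qed
  qed
qed

text \<open>The interval {x..1} is closed and still contains the atom when x = 1/2. This agrees with
  the left limit taken by \<open>ddvel\<close>, so the projection formula can hold at every point,
  including the knot.\<close>

lemma AE_U_meas_line_measure: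
  assumes g: "g \<in> borel_measurable borel" "\<And>t. t \<in> {0..1} \<Longrightarrow> 0 \<le> g t"
    and q: "\<And>t. t \<in> {0..1} \<Longrightarrow> continuous_on {0..1} (eta (q t))"
  shows "AE t in I01. \<forall>x\<in>{0..1}. U_meas (line_measure g) q t x = (if x \<le> 1/2 then g t * eta (q t) (1/2) / 2 else 0)"
proof -
  define K where "K = (SOME K. disintegration (line_measure g) K)"
  have "disintegration (line_measure g) K"
    unfolding K_def by (rule someI[of "disintegration (line_measure g)", OF disintegration_line_measure[OF g(1)]])
  from disintegration_line_measure_unique[OF g this]
  have *: "AE t in I01. \<forall>f\<in>borel_measurable (restrict_space borel {0..1}). (LINT y|K t. f y) = g t * f (1/2 :: real)" .
  moreover have "AE t in I01. t \<in> {0..1}" by (rule AE_I2) simp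
  ultimately show ?thesis
  proof eventually_elim
    case (elim t)
    show ?case
    proof
      fix x :: real assume x: "x \<in> {0..1}"
      have "eta (q t) \<in> borel_measurable (restrict_space borel {0..1})"
        using q[OF elim(2)] by (rule borel_measurable_continuous_on_restrict)
      moreover have "indicator {x..1} \<in> borel_measurable (restrict_space borel {0..1})"
        by (rule measurable_restrict_space1) simp
      ultimately have "(\<lambda>y. indicator {x..1} y *\<^sub>R eta (q t) y) \<in> borel_measurable (restrict_space borel {0..1})"
        by measurable
      then show "U_meas (line_measure g) q t x = (if x \<le> 1/2 then g t * eta (q t) (1/2) / 2 else 0)"
        unfolding U_meas_def Let_def K_def[symmetric] set_lebesgue_integral_def
        using elim(1) by (simp add: indicator_def)
    qed
  qed
qed

text \<open>The momentum of the geodesic is itself the projection of a step function. Hence adding a measure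
  over the knot perturbs the covariant derivative along \<open>p\<close> only.\<close>

lemma pi_star_step:
  assumes t: "0 \<le> t" and f: "\<And>x. x \<in> {0..1} \<Longrightarrow> f x = (if x \<le> 1/2 then c else 0)" and x: "x \<in> {0..1}"
  shows "pi_star (q_geo t) f x = - (c / 8) * p_geo t x"
proof -
  let ?h = "\<lambda>y. if y \<le> 1/2 then c else (0::real)"
  \<comment> \<open>The flow keeps each half of the interval, so the step is the same function of y
    = \<open>flow t x\<close>. Its moments c/2 and c/8 then give the projection.\<close>
  have f': "f x = ?h (flow t x)" if "x \<in> {0..1}" for x
    using f[OF that] flow_le_half_iff[OF that, of t] by simp
  have der: "((\<lambda>y. min y (1/2)) has_real_derivative (if y \<le> 1/2 then 1 else 0)) (at y)" if "y \<in> noknot" for y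
  proof -
    have "((\<lambda>y. if y \<le> 1/2 then y else 1/2) has_real_derivative (if y \<le> 1/2 then 1 else 0)) (at y)"
      by (rule DERIV_glue_off) (use that in auto)
    then show ?thesis by (simp add: min_def)
  qed
  have "inner_eta (q_geo t) f (\<lambda>_. 1) = c * min 1 (1/2) - c * min 0 (1/2)"
  proof (rule inner_eta_one[OF t, where f = ?h and B = "\<bar>c\<bar>"])
    show "((\<lambda>y. c * min y (1/2)) has_real_derivative ?h y) (at y)" if "y \<in> noknot" for y
      using DERIV_cmult[OF der[OF that], of c] by (simp split: if_splits)
  next
    show "f x = ?h (flow t x)" if "x \<in> {0..1}" for x by (rule f'[OF that])
  qed (auto intro!: continuous_intros)
  then have one: "inner_eta (q_geo t) f (\<lambda>_. 1) = c / 2" by simp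
  have "inner_eta (q_geo t) f (phi (q_geo t)) = c / 2 * (min 1 (1/2))\<^sup>2 - c / 2 * (min 0 (1/2))\<^sup>2"
  proof (rule inner_eta_phi[OF t, where f = ?h and B = "\<bar>c\<bar>"])
    show "((\<lambda>y. c / 2 * (min y (1/2))\<^sup>2) has_real_derivative ?h y * y) (at y)" if "y \<in> noknot" for y
      using DERIV_cmult[OF DERIV_power[OF der[OF that], of 2], of "c / 2"]
      by (auto split: if_splits simp: min_def)
  next
    show "f x = ?h (flow t x)" if "x \<in> {0..1}" for x by (rule f'[OF that])
  qed (auto intro!: continuous_intros)
  then have phi: "inner_eta (q_geo t) f (phi (q_geo t)) = c / 8" by (simp add: power2_eq_square)
  show ?thesis
    using f'[OF x] x t
    by (auto simp: pi_star_def one phi span_comb_eq phi_q_geo p_geo_def ddvel_def field_simps)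
qed

text \<open>Conservation of energy: substitution leaves the integral of (v'')^2 = 4 - 24 v' over the
  unit interval, and v vanishes at both ends.\<close>

lemma nn_integral_eta_p_geo_sq:
  assumes "0 \<le> t"
  shows "(\<integral>\<^sup>+ x. ennreal (eta (q_geo t) x * (d * p_geo t x)\<^sup>2) \<partial>I01) = ennreal (4 * d\<^sup>2)"
proof -
  have meas: "(\<lambda>x. jac t x * (d * p_geo t x)\<^sup>2) \<in> borel_measurable borel" by measurable
  have int: "set_integrable lborel {0..1} (\<lambda>x. jac t x * (d * p_geo t x)\<^sup>2)"
    unfolding set_integrable_def
  proof (rule integrableI_bounded_set_indicator[where B = "exp (t / 2) * (\<bar>d\<bar> * 4)\<^sup>2"])
    have "norm (jac t x * (d * p_geo t x)\<^sup>2) \<le> exp (t / 2) * (\<bar>d\<bar> * 4)\<^sup>2" if "x \<in> {0..1}" for x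
    proof -
      have "(\<bar>d\<bar> * \<bar>p_geo t x\<bar>)\<^sup>2 \<le> (\<bar>d\<bar> * 4)\<^sup>2"
        using p_geo_bound[OF that, of t] by (intro power_mono mult_left_mono) auto
      then have "(d * p_geo t x)\<^sup>2 \<le> (\<bar>d\<bar> * 4)\<^sup>2" by (simp add: power_mult_distrib)
      then show ?thesis
        using jac_bound[OF that assms] jac_pos[of t x] by (auto simp: abs_mult intro!: mult_mono)
    qed
    then show "AE x in lborel. x \<in> {0..1} \<longrightarrow> norm (jac t x * (d * p_geo t x)\<^sup>2) \<le> exp (t / 2) * (\<bar>d\<bar> * 4)\<^sup>2"
      by simp
  qed (use meas in auto)
  have "(LINT x:{0..1}|lborel. jac t x * (d * p_geo t x)\<^sup>2) = (LINT x:{0..1}|lborel. d\<^sup>2 * (ddvel (flow t x))\<^sup>2 * jac t x)"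
    by (intro set_lebesgue_integral_cong) (auto simp: p_geo_def power_mult_distrib)
  also have "\<dots> = d\<^sup>2 * (4 * flow t 1 - 24 * vel (flow t 1)) - d\<^sup>2 * (4 * flow t 0 - 24 * vel (flow t 0))"
  proof (rule LINT_flow_substitution[where f = "\<lambda>y. d\<^sup>2 * (ddvel y)\<^sup>2" and B = "d\<^sup>2 * 4\<^sup>2"])
    show "((\<lambda>y. d\<^sup>2 * (4 * y - 24 * vel y)) has_real_derivative d\<^sup>2 * (ddvel y)\<^sup>2) (at y)" for y
      unfolding ddvel_sq by (auto intro!: derivative_eq_intros DERIV_vel)
    show "\<bar>d\<^sup>2 * (ddvel y)\<^sup>2\<bar> \<le> d\<^sup>2 * 4\<^sup>2" if "y \<in> {0..1}" for y
      using power_mono[OF ddvel_bound[OF that], of 2] by (auto simp: abs_mult intro!: mult_left_mono)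
  qed (use assms in \<open>auto intro!: continuous_intros continuous_on_vel\<close>)
  finally have "(LINT x:{0..1}|lborel. jac t x * (d * p_geo t x)\<^sup>2) = 4 * d\<^sup>2" by (simp add: vel_unit)
  moreover have "(\<integral>\<^sup>+ x. ennreal (eta (q_geo t) x * (d * p_geo t x)\<^sup>2) \<partial>I01)
      = (\<integral>\<^sup>+ x. ennreal (jac t x * (d * p_geo t x)\<^sup>2) \<partial>I01)"
    using assms by (intro nn_integral_cong) (simp add: eta_q_geo)
  moreover have "\<dots> = ennreal (LINT x|I01. jac t x * (d * p_geo t x)\<^sup>2)"
    using int jac_pos[of t] by (intro nn_integral_eq_integral) (auto simp: integrable_I01 less_imp_le)
  ultimately show ?thesis by (simp add: LINT_I01)
qed

section \<open>The reparametrized curve\<close>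

text \<open>With t^n in place of t^6, bounding the exponential below by 1/2 gives a gain of n (n -
  1) / (4 (n + 1)) against a cost of at most 1. This is 5/6 for n = 5 and 15/14 for n = 6, so 6 is
  the first exponent for which this crude bound is enough.\<close>

definition p_curve :: "real \<Rightarrow> real \<Rightarrow> real" where
  "p_curve t x = 6 * t ^ 5 * p_geo (t ^ 6) x"

definition q_curve :: "real \<Rightarrow> real \<Rightarrow> real" where
  "q_curve t = q_geo (t ^ 6)"

definition p_curve_deriv :: "real \<Rightarrow> real \<Rightarrow> real" where
  "p_curve_deriv t x = 30 * t ^ 4 * p_geo (t ^ 6) x + (6 * t ^ 5)\<^sup>2 * (-12 * vel (flow (t ^ 6) x))"

definition q_curve_deriv :: "real \<Rightarrow> real \<Rightarrow> real" where
  "q_curve_deriv t x = jac (t ^ 6) x * p_curve t x"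

definition q_curve_deriv2 :: "real \<Rightarrow> real \<Rightarrow> real" where
  "q_curve_deriv2 t x = jac (t ^ 6) x * (6 * t ^ 5 * dvel (flow (t ^ 6) x) * p_curve t x + p_curve_deriv t x)"

lemma DERIV_pow6: "((\<lambda>t. t ^ 6) has_real_derivative 6 * t ^ 5) (at t)" for t :: real
  by (auto intro!: derivative_eq_intros)

lemma DERIV_p_curve:
  assumes "x \<in> noknot"
  shows "((\<lambda>t. p_curve t x) has_real_derivative p_curve_deriv t x) (at t)"
  using DERIV_chain2[OF DERIV_p_geo_time[OF assms] DERIV_pow6, of t]
  unfolding p_curve_def p_curve_deriv_def
  by (auto intro!: derivative_eq_intros simp: power2_eq_square algebra_simps)

lemma DERIV_q_curve:
  assumes "x \<in> noknot"
  shows "((\<lambda>t. q_curve t x) has_real_derivative q_curve_deriv t x) (at t)"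
  using DERIV_chain2[OF DERIV_q_geo_time[OF assms] DERIV_pow6, of t]
  by (simp add: q_curve_def q_curve_deriv_def p_curve_def mult_ac)

lemma DERIV_q_curve_deriv:
  assumes "x \<in> noknot"
  shows "((\<lambda>t. q_curve_deriv t x) has_real_derivative q_curve_deriv2 t x) (at t)"
  using DERIV_mult[OF DERIV_chain2[OF DERIV_jac_time[OF assms] DERIV_pow6] DERIV_p_curve[OF assms], of t]
  by (simp add: q_curve_deriv_def q_curve_deriv2_def algebra_simps)

lemma borel_measurable_p_curve [measurable]: "(\<lambda>(t, x). p_curve t x) \<in> borel_measurable (borel \<Otimes>\<^sub>M borel)"
  unfolding p_curve_def by measurable

lemma borel_measurable_p_curve_deriv [measurable]:
  "(\<lambda>(t, x). p_curve_deriv t x) \<in> borel_measurable (borel \<Otimes>\<^sub>M borel)"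
  unfolding p_curve_deriv_def by measurable

lemma borel_measurable_q_curve_deriv [measurable]:
  "(\<lambda>(t, x). q_curve_deriv t x) \<in> borel_measurable (borel \<Otimes>\<^sub>M borel)"
  unfolding q_curve_deriv_def by measurable

lemma borel_measurable_q_curve_deriv2 [measurable]:
  "(\<lambda>(t, x). q_curve_deriv2 t x) \<in> borel_measurable (borel \<Otimes>\<^sub>M borel)"
  unfolding q_curve_deriv2_def by measurable

lemma abs_pow_le_one: "t \<in> {0..1} \<Longrightarrow> \<bar>t ^ n\<bar> \<le> 1" for t :: real
  by (simp add: power_le_one)

lemma p_curve_bound:
  assumes "t \<in> {0..1}" "x \<in> {0..1}"
  shows "\<bar>p_curve t x\<bar> \<le> 6 * 1 * 4"
  unfolding p_curve_def abs_mult
  by (intro mult_mono abs_pow_le_one p_geo_bound assms) auto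

lemma p_curve_deriv_bound:
  assumes "t \<in> {0..1}" "x \<in> {0..1}"
  shows "\<bar>p_curve_deriv t x\<bar> \<le> 30 * 1 * 4 + (6 * 1)\<^sup>2 * (12 * 1)"
proof -
  have "\<bar>30 * t ^ 4 * p_geo (t ^ 6) x\<bar> \<le> 30 * 1 * 4"
    unfolding abs_mult by (intro mult_mono abs_pow_le_one p_geo_bound assms) auto
  moreover have "\<bar>(6 * t ^ 5)\<^sup>2 * (-12 * vel (flow (t ^ 6) x))\<bar> \<le> (6 * 1)\<^sup>2 * (12 * 1)"
    unfolding abs_mult power_abs
    by (intro mult_mono power_mono) (use abs_pow_le_one[OF assms(1)] vel_bound flow_in assms(2) in \<open>auto simp flip: power_abs\<close>)
  ultimately show ?thesis unfolding p_curve_deriv_def by (intro order_trans[OF abs_triangle_ineq] add_mono)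
qed

lemma jac_pow6_bound:
  assumes "t \<in> {0..1}" "x \<in> {0..1}"
  shows "\<bar>jac (t ^ 6) x\<bar> \<le> exp (1/2)"
proof -
  have "jac (t ^ 6) x \<le> exp (t ^ 6 / 2)" by (rule jac_bound) (use assms in auto)
  also have "\<dots> \<le> exp (1/2)" using abs_pow_le_one[OF assms(1), of 6] by simp
  finally show ?thesis using jac_pos[of "t ^ 6" x] by simp
qed

lemma q_curve_deriv_bound:
  assumes "t \<in> {0..1}" "x \<in> {0..1}"
  shows "\<bar>q_curve_deriv t x\<bar> \<le> exp (1/2) * 24"
  unfolding q_curve_deriv_def abs_mult
  using jac_pow6_bound[OF assms] p_curve_bound[OF assms] by (intro mult_mono) auto

lemma q_curve_deriv2_bound:
  assumes "t \<in> {0..1}" "x \<in> {0..1}"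
  shows "\<bar>q_curve_deriv2 t x\<bar> \<le> exp (1/2) * (6 * 1 * (1/2) * (6 * 1 * 4) + (30 * 1 * 4 + (6 * 1)\<^sup>2 * (12 * 1)))"
proof -
  have "\<bar>6 * t ^ 5 * dvel (flow (t ^ 6) x) * p_curve t x\<bar> \<le> 6 * 1 * (1/2) * (6 * 1 * 4)"
    unfolding abs_mult
    by (intro mult_mono abs_pow_le_one dvel_bound flow_in p_curve_bound assms) auto
  then have "\<bar>6 * t ^ 5 * dvel (flow (t ^ 6) x) * p_curve t x + p_curve_deriv t x\<bar>
      \<le> 6 * 1 * (1/2) * (6 * 1 * 4) + (30 * 1 * 4 + (6 * 1)\<^sup>2 * (12 * 1))"
    by (intro order_trans[OF abs_triangle_ineq] add_mono p_curve_deriv_bound assms)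
  then show ?thesis
    unfolding q_curve_deriv2_def abs_mult[of "jac _ _"]
    using jac_pow6_bound[OF assms] by (intro mult_mono) auto
qed

lemma time_reparametrization_pow6: "time_reparametrization (\<lambda>t. t ^ 6) (\<lambda>t. 6 * t ^ 5)"
  unfolding time_reparametrization_def
  by (auto intro!: strict_mono_onI power_strict_mono has_field_derivative_at_within[OF DERIV_pow6])

lemma H1_curve_p_curve: "H1_curve p_curve p_curve_deriv"
proof (rule H1_curve_C1[OF borel_measurable_p_curve_deriv p_curve_deriv_bound])
  show "p_curve t \<in> L2_01" if "t \<in> {0..1}" for t
    by (rule L2_01_bounded[OF _ p_curve_bound[OF that]]) measurable
qed (auto intro!: DERIV_p_curve)

lemma H2_curve_q_curve: "H2_curve q_curve q_curve_deriv q_curve_deriv2"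
  unfolding H2_curve_def
proof
  show "H1_curve q_curve q_curve_deriv"
  proof (rule H1_curve_C1[OF borel_measurable_q_curve_deriv q_curve_deriv_bound])
    show "q_curve t \<in> L2_01" for t
      using q_geo_in_Q_space[of "t ^ 6"] by (simp add: q_curve_def Q_space_def)
  qed (auto intro!: DERIV_q_curve)
  show "H1_curve q_curve_deriv q_curve_deriv2"
  proof (rule H1_curve_C1[OF borel_measurable_q_curve_deriv2 q_curve_deriv2_bound])
    show "q_curve_deriv t \<in> L2_01" if "t \<in> {0..1}" for t
      by (rule L2_01_bounded[OF _ q_curve_deriv_bound[OF that]]) measurable
  qed (auto intro!: DERIV_q_curve_deriv)
qed

lemma cotangent_scale:
  assumes "p \<in> cotangent q"
  shows "(\<lambda>x. c * p x) \<in> cotangent q"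
  using assms by (auto simp: cotangent_def L2_01_def power_mult_distrib inner_eta_scale)

lemma L2_eq_refl: "L2_eq f f"
  by (simp add: L2_eq_def)

text \<open>Both end values are prescribed; membership with a free final value is the weaker
  condition.\<close>

lemma curve_in_curves_C:
  "(p_curve, q_curve) \<in> curves_C (p_curve 0, q_curve 0) (Some (p_curve 1, q_curve 1))"
proof -
  have "q_curve t \<in> Q_space" "p_curve t \<in> cotangent (q_curve t)" for t
    using q_geo_in_Q_space[of "t ^ 6"] cotangent_scale[OF p_geo_in_cotangent[of "t ^ 6"], of "6 * t ^ 5"]
    by (simp_all add: q_curve_def p_curve_def[abs_def])
  moreover have "L2_eq (q_curve_deriv t) (\<lambda>x. eta (q_curve t) x * p_curve t x)" for t
    unfolding L2_eq_def by (intro AE_I2) (simp add: q_curve_deriv_def q_curve_def eta_q_geo)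
  ultimately show ?thesis
    unfolding curves_C_def using H2_curve_q_curve L2_eq_refl by auto
qed

lemma covar_flat_p_curve:
  assumes "x \<in> {0..1}"
  shows "covar_flat (p_curve_deriv t) (p_curve t) (q_curve t) x = 30 * t ^ 4 * p_geo (t ^ 6) x"
  using covar_flat_reparametrize[of "30 * t ^ 4" "p_geo (t ^ 6)" "6 * t ^ 5" "\<lambda>x. -12 * vel (flow (t ^ 6) x)" "q_geo (t ^ 6)" x]
    covar_flat_geo[OF assms, of "t ^ 6"]
  by (simp add: p_curve_def[abs_def] q_curve_def p_curve_deriv_def[abs_def])

lemma covar_flat_cong: "a x = b x \<Longrightarrow> covar_flat a p q x = covar_flat b p q x"
  by (simp add: covar_flat_def)

section \<open>The second term of the functional for measures on the line\<close>

definition kinetic :: "(real \<times> real) measure \<Rightarrow> ennreal" where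
  "kinetic \<Delta> = (\<integral>\<^sup>+ t. (\<integral>\<^sup>+ x. ennreal (eta (q_curve t) x *
      (covar_flat (H1_deriv p_curve t) (p_curve t) (q_curve t) x + pi_star (q_curve t) (U_meas \<Delta> q_curve t) x)\<^sup>2)
    \<partial>I01) \<partial>I01)"

lemma eta_q_curve_half: "eta (q_curve t) (1/2) = exp (- (t ^ 6) / 2)"
  by (simp add: q_curve_def eta_q_geo)

text \<open>Acceleration and perturbation are both multiples of \<open>p_geo\<close>, whose squared
  norm is 4, so only a scalar square remains. The factor 1/16 combines 1/2 from U with 1/8 from the
  projection of a step. Equality holds for almost every t, as both the Sobolev derivative and the
  disintegration are known only up to null sets.\<close>

lemma kinetic_line_measure:
  assumes g: "g \<in> borel_measurable borel" "\<And>t. t \<in> {0..1} \<Longrightarrow> 0 \<le> g t"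
  shows "kinetic (line_measure g) = (\<integral>\<^sup>+ t. ennreal (4 * (30 * t ^ 4 - g t * exp (- (t ^ 6) / 2) / 16)\<^sup>2) \<partial>I01)"
  unfolding kinetic_def
proof (rule nn_integral_cong_AE)
  have "continuous_on {0..1} (eta (q_curve t))" for t
    using continuous_on_jac[of "t ^ 6"] by (rule continuous_on_eq) (simp_all add: q_curve_def eta_q_geo)
  then have U: "AE t in I01. \<forall>x\<in>{0..1}. U_meas (line_measure g) q_curve t x
      = (if x \<le> 1/2 then g t * exp (- (t ^ 6) / 2) / 2 else 0)"
    using AE_U_meas_line_measure[OF g, of q_curve] by (simp only: eta_q_curve_half)
  show "AE t in I01. (\<integral>\<^sup>+ x. ennreal (eta (q_curve t) x *
        (covar_flat (H1_deriv p_curve t) (p_curve t) (q_curve t) x + pi_star (q_curve t) (U_meas (line_measure g) q_curve t) x)\<^sup>2)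
      \<partial>I01) = ennreal (4 * (30 * t ^ 4 - g t * exp (- (t ^ 6) / 2) / 16)\<^sup>2)"
    using U AE_H1_deriv[OF H1_curve_p_curve]
  proof eventually_elim
    case (elim t)
    let ?d = "30 * t ^ 4 - g t * exp (- (t ^ 6) / 2) / 16"
    have "AE x in I01. x \<in> {0..1}" by (rule AE_I2) simp
    with elim(2) have "AE x in I01. ennreal (eta (q_curve t) x *
        (covar_flat (H1_deriv p_curve t) (p_curve t) (q_curve t) x + pi_star (q_curve t) (U_meas (line_measure g) q_curve t) x)\<^sup>2)
      = ennreal (eta (q_geo (t ^ 6)) x * (?d * p_geo (t ^ 6) x)\<^sup>2)"
    proof eventually_elim
      case (elim x)
      have "covar_flat (H1_deriv p_curve t) (p_curve t) (q_curve t) x = 30 * t ^ 4 * p_geo (t ^ 6) x"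
        using covar_flat_cong[of "H1_deriv p_curve t" x "p_curve_deriv t", OF elim(1)] covar_flat_p_curve[OF elim(2)] by simp
      moreover have "pi_star (q_curve t) (U_meas (line_measure g) q_curve t) x
          = - (g t * exp (- (t ^ 6) / 2) / 2 / 8) * p_geo (t ^ 6) x"
        unfolding q_curve_def[of t]
        by (rule pi_star_step) (use \<open>\<forall>x\<in>{0..1}. U_meas _ _ _ x = _\<close> elim in auto)
      ultimately have "covar_flat (H1_deriv p_curve t) (p_curve t) (q_curve t) x
          + pi_star (q_curve t) (U_meas (line_measure g) q_curve t) x = ?d * p_geo (t ^ 6) x"
        by (simp add: algebra_simps)
      then show ?case by (simp add: q_curve_def)
    qed
    then have "(\<integral>\<^sup>+ x. ennreal (eta (q_curve t) x *
        (covar_flat (H1_deriv p_curve t) (p_curve t) (q_curve t) x + pi_star (q_curve t) (U_meas (line_measure g) q_curve t) x)\<^sup>2)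
      \<partial>I01) = (\<integral>\<^sup>+ x. ennreal (eta (q_geo (t ^ 6)) x * (?d * p_geo (t ^ 6) x)\<^sup>2) \<partial>I01)"
      by (rule nn_integral_cong_AE)
    also have "\<dots> = ennreal (4 * ?d\<^sup>2)"
      by (rule nn_integral_eta_p_geo_sq) simp
    finally show ?case .
  qed
qed

section \<open>Numerical comparison of the two values\<close>

lemma nn_integral_I01_FTC:
  fixes F f :: "real \<Rightarrow> real"
  assumes "\<And>t. t \<in> {0..1} \<Longrightarrow> (F has_real_derivative f t) (at t)" "f \<in> borel_measurable borel"
    and "\<And>t. t \<in> {0..1} \<Longrightarrow> 0 \<le> f t \<and> f t \<le> B"
  shows "(\<integral>\<^sup>+ t. ennreal (f t) \<partial>I01) = ennreal (F 1 - F 0)"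
proof -
  have cont: "continuous_on {0..1} F"
    using assms(1) DERIV_isCont by (blast intro: continuous_at_imp_continuous_on)
  note * = LINT_FTC[OF zero_le_one finite.emptyI cont _ assms(2), of B]
  have "integrable I01 f" "(LINT t|I01. f t) = F 1 - F 0"
    unfolding integrable_I01 LINT_I01 using * assms by force+
  then show ?thesis using assms(3) by (subst nn_integral_eq_integral) auto
qed

lemma kinetic_zero: "kinetic zero_D = 400"
proof -
  have "kinetic zero_D = (\<integral>\<^sup>+ t. ennreal (3600 * t ^ 8) \<partial>I01)"
    unfolding zero_D_eq_line_measure by (subst kinetic_line_measure) (auto simp: power2_eq_square)
  also have "\<dots> = ennreal (400 * 1 ^ 9 - 400 * 0 ^ 9)"
    by (rule nn_integral_I01_FTC[where B = "3600"])
      (auto intro!: derivative_eq_intros simp: power_le_one)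
  finally show ?thesis by simp
qed

text \<open>For a strict decrease an upper bound is enough, so the infimum is evaluated at the
  explicit derivative.\<close>

lemma FR_term_le:
  "FR_term (line_measure (\<lambda>t. t\<^sup>2)) q_curve \<le> (\<integral>\<^sup>+ t. ennreal (exp (- (t ^ 6) / 2)) \<partial>I01)"
proof -
  let ?S = "restrict_space borel unit_square :: (real \<times> real) measure"
  have "(\<lambda>(t, x). eta (q_curve t) x) \<in> borel_measurable ?S"
  proof (subst measurable_cong)
    show "(\<lambda>(t, x). eta (q_curve t) x) z = (\<lambda>(t, x). jac (t ^ 6) x) z" if "z \<in> space ?S" for z
      using that by (auto simp: space_restrict_space unit_square_def q_curve_def eta_q_geo)
    have "(\<lambda>(t, x). jac (t ^ 6) x) \<in> borel_measurable (borel \<Otimes>\<^sub>M borel)" by measurable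
    then show "(\<lambda>(t, x). jac (t ^ 6) x) \<in> borel_measurable ?S"
      unfolding borel_prod by (rule measurable_restrict_space1)
  qed
  from FR_line_measure[OF this]
  have "FR (\<lambda>(t, x). eta (q_curve t) x) (line_measure (\<lambda>t. t\<^sup>2), zero_D) (line_measure (\<lambda>t. 2 * t), zero_D)
      = (\<integral>\<^sup>+ t. ennreal (exp (- (t ^ 6) / 2)) \<partial>I01)"
    by (simp add: eta_q_curve_half)
  moreover have "FR_term (line_measure (\<lambda>t. t\<^sup>2)) q_curve
      \<le> FR (\<lambda>(t, x). eta (q_curve t) x) (line_measure (\<lambda>t. t\<^sup>2), zero_D) (line_measure (\<lambda>t. 2 * t), zero_D)"
    unfolding FR_term_def
    by (rule INF_lower) (use line_derivative_in_signed_D weak_time_derivative_line_measure in blast)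
  ultimately show ?thesis by simp
qed

text \<open>After expanding the square, the exponential is bounded above by 1 in the cost and in the
  quadratic term. It is bounded below by 1/2, via exp u \<ge> 1 + u, in the negative cross
  term.\<close>

lemma integrand_bound:
  assumes "t \<in> {0..1::real}"
  shows "exp (- (t ^ 6) / 2) + 4 * (30 * t ^ 4 - t\<^sup>2 * exp (- (t ^ 6) / 2) / 16)\<^sup>2
    \<le> 1 - 15/2 * t ^ 6 + 3600 * t ^ 8 + t ^ 4 / 64"
proof -
  define e where "e = exp (- (t ^ 6) / 2)"
  have t6: "0 \<le> t ^ 6" "t ^ 6 \<le> 1" using assms by (auto simp: power_le_one)
  have e: "e \<le> 1" "0 < e" using t6 by (auto simp: e_def)
  have "1/2 \<le> 1 + (- (t ^ 6) / 2)" using t6 by simp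
  also have "\<dots> \<le> e" unfolding e_def by (rule exp_ge_add_one_self)
  finally have "1/2 \<le> e" .
  then have "1/2 * t ^ 6 \<le> e * t ^ 6" using t6 by (intro mult_right_mono) auto
  moreover have "t ^ 4 * e\<^sup>2 \<le> t ^ 4 * 1"
    using e by (intro mult_left_mono) (auto simp: power_le_one)
  moreover have "4 * (30 * t ^ 4 - t\<^sup>2 * e / 16)\<^sup>2 = 3600 * t ^ 8 - 15 * (e * t ^ 6) + t ^ 4 * e\<^sup>2 / 64"
    by (simp add: power2_eq_square eval_nat_numeral algebra_simps)
  ultimately show ?thesis using e(1) unfolding e_def[symmetric] by linarith
qed

lemma functional_line_measure:
  "FR_term (line_measure (\<lambda>t. t\<^sup>2)) q_curve + kinetic (line_measure (\<lambda>t. t\<^sup>2)) < 400"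
proof -
  have m: "(\<lambda>t::real. ennreal (exp (- (t ^ 6) / 2))) \<in> borel_measurable I01"
    "(\<lambda>t::real. ennreal (4 * (30 * t ^ 4 - t\<^sup>2 * exp (- (t ^ 6) / 2) / 16)\<^sup>2)) \<in> borel_measurable I01"
    by (intro measurable_compose[OF borel_measurable_I01 measurable_ennreal]; measurable)+
  have "FR_term (line_measure (\<lambda>t. t\<^sup>2)) q_curve + kinetic (line_measure (\<lambda>t. t\<^sup>2))
      \<le> (\<integral>\<^sup>+ t. ennreal (exp (- (t ^ 6) / 2)) \<partial>I01)
        + (\<integral>\<^sup>+ t. ennreal (4 * (30 * t ^ 4 - t\<^sup>2 * exp (- (t ^ 6) / 2) / 16)\<^sup>2) \<partial>I01)"
    by (intro add_mono FR_term_le) (simp add: kinetic_line_measure)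
  also have "\<dots> = (\<integral>\<^sup>+ t. ennreal (exp (- (t ^ 6) / 2) + 4 * (30 * t ^ 4 - t\<^sup>2 * exp (- (t ^ 6) / 2) / 16)\<^sup>2) \<partial>I01)"
    by (subst nn_integral_add[symmetric]) (use m in \<open>auto simp: ennreal_plus\<close>)
  also have "\<dots> \<le> (\<integral>\<^sup>+ t. ennreal (1 - 15/2 * t ^ 6 + 3600 * t ^ 8 + t ^ 4 / 64) \<partial>I01)"
    by (intro nn_integral_mono ennreal_leI integrand_bound) simp
  \<comment> \<open>The value is 400 - 1/14 + 1/320: the net first-order gain 1/14 outweighs the
    quadratic term 1/320.\<close>
  also have "\<dots> = ennreal ((1 - 15/14 * 1 ^ 7 + 400 * 1 ^ 9 + 1 ^ 5 / 320)
      - (0 - 15/14 * 0 ^ 7 + 400 * 0 ^ 9 + 0 ^ 5 / 320))"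
  proof (rule nn_integral_I01_FTC[where B = "3602" and F = "\<lambda>t. t - 15/14 * t ^ 7 + 400 * t ^ 9 + t ^ 5 / 320"])
    fix t :: real assume t: "t \<in> {0..1}"
    show "((\<lambda>t. t - 15/14 * t ^ 7 + 400 * t ^ 9 + t ^ 5 / 320) has_real_derivative
        1 - 15/2 * t ^ 6 + 3600 * t ^ 8 + t ^ 4 / 64) (at t)"
      by (auto intro!: derivative_eq_intros)
    \<comment> \<open>Nonnegativity of the polynomial is inherited from the integrand that it
      dominates.\<close>
    have "0 \<le> exp (- (t ^ 6) / 2) + 4 * (30 * t ^ 4 - t\<^sup>2 * exp (- (t ^ 6) / 2) / 16)\<^sup>2" by simp
    moreover have "t ^ 8 \<le> 1" "t ^ 4 \<le> 1" "0 \<le> t ^ 6" using t by (auto simp: power_le_one)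
    ultimately show "0 \<le> 1 - 15/2 * t ^ 6 + 3600 * t ^ 8 + t ^ 4 / 64 \<and> 1 - 15/2 * t ^ 6 + 3600 * t ^ 8 + t ^ 4 / 64 \<le> 3602"
      using integrand_bound[OF t] by linarith
  qed simp
  also have "\<dots> < ennreal 400"
    by (subst ennreal_less_iff) auto
  finally show ?thesis by simp
qed

text \<open>The final term is the same real number for both measures. Being finite, it preserves the
  strict inequality.\<close>

lemma enn2ereal_plus_less:
  assumes "a < b"
  shows "enn2ereal a + ereal c < enn2ereal b + ereal c"
proof -
  have "enn2ereal a < enn2ereal b" using assms by (simp add: less_ennreal.rep_eq)
  then show ?thesis by (cases "enn2ereal a"; cases "enn2ereal b") auto
qed

theorem proposition7p13:
  fixes P :: "(real \<Rightarrow> real) \<Rightarrow> (real \<Rightarrow> real) \<Rightarrow> real"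
  shows "\<exists>\<alpha> \<alpha>' p\<^sub>0 q\<^sub>0. time_reparametrization \<alpha> \<alpha>' \<and> geodesic p\<^sub>0 q\<^sub>0 \<and>
    (let p = (\<lambda>t x. \<alpha>' t * p\<^sub>0 (\<alpha> t) x); q = (\<lambda>t. q\<^sub>0 (\<alpha> t)) in
       (p, q) \<in> curves_C (p 0, q 0) (Some (p 1, q 1)) \<and>
       \<not> (\<forall>\<Delta>\<in>M0. F_functional P zero_D p q \<le> F_functional P \<Delta> p q))"
proof (intro exI conjI)
  show "time_reparametrization (\<lambda>t. t ^ 6) (\<lambda>t. 6 * t ^ 5)" by (rule time_reparametrization_pow6)
  show "geodesic p_geo q_geo" by (rule geodesic_geo)
  have F: "F_functional P \<Delta> p_curve q_curve
      = enn2ereal (FR_term \<Delta> q_curve + kinetic \<Delta>) + ereal (P (p_curve 1) (q_curve 1))" for \<Delta>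
    by (simp add: F_functional_def kinetic_def)
  have "F_functional P (line_measure (\<lambda>t. t\<^sup>2)) p_curve q_curve < enn2ereal 400 + ereal (P (p_curve 1) (q_curve 1))"
    unfolding F by (rule enn2ereal_plus_less[OF functional_line_measure])
  \<comment> \<open>For \<Delta> = 0 only the second term is computed; the Fisher-Rao term enters
    through its nonnegativity.\<close>
  also have "\<dots> \<le> F_functional P zero_D p_curve q_curve"
    unfolding F kinetic_zero
    by (intro add_right_mono) (simp only: add_increasing flip: less_eq_ennreal.rep_eq, simp)
  finally have "\<not> (\<forall>\<Delta>\<in>M0. F_functional P zero_D p_curve q_curve \<le> F_functional P \<Delta> p_curve q_curve)"
    using line_measure_in_M0 by (meson leD)
  then have result: "let p = p_curve; q = q_curve in
       (p, q) \<in> curves_C (p 0, q 0) (Some (p 1, q 1)) \<and>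
       \<not> (\<forall>\<Delta>\<in>M0. F_functional P zero_D p q \<le> F_functional P \<Delta> p q)"
    unfolding Let_def using curve_in_curves_C by blast
  have curves: "p_curve = (\<lambda>t x. 6 * t ^ 5 * p_geo (t ^ 6) x)" "q_curve = (\<lambda>t. q_geo (t ^ 6))"
    by (simp_all add: fun_eq_iff p_curve_def q_curve_def)
  show "let p = (\<lambda>t x. 6 * t ^ 5 * p_geo (t ^ 6) x); q = (\<lambda>t. q_geo (t ^ 6)) in
       (p, q) \<in> curves_C (p 0, q 0) (Some (p 1, q 1)) \<and>
       \<not> (\<forall>\<Delta>\<in>M0. F_functional P zero_D p q \<le> F_functional P \<Delta> p q)"
    by (rule result[unfolded curves])
qed

end
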